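(* Let $N\ge1$ be an integer, $p\in[2,+\infty)$, and $\gamma:=\frac{2}{N(p-1)}$. There exists a constant $C=C(N,p)>0$, depending only on $N$ and $p$ (namely the same constant $C(N,p)$ as in the energy inequality recalled in the context), such that the following holds. Let $J\in L^1(\mathbb{R}^N)$ be a measurable function $J:\mathbb{R}^N\to[0,+\infty)$ and let $r,R>0$ be such that $J(z)\ge r$ for all $|z|<R$. Let $u_0\in L^1(\mathbb{R}^N)\cap L^p(\mathbb{R}^N)$ and let $u=u(t,x)$ be the solution to $$\partial_t u(t,x)=\int_{\mathbb{R}^N}J(x-y)\big(u(t,y)-u(t,x)\big)\,dy,\qquad u(0,x)=u_0(x),\qquad t\ge 0,\ x\in\mathbb{R}^N.$$ Then $$\|u(t,\cdot)\|_p^p\le\begin{cases}\|u_0\|_p^p & \text{for }0\le t\le t_0,\\[1mm] \Big(\|u_0\|_p^{-p\gamma}+C\gamma\, r\,R^{N+2}\,\|u_0\|_1^{-p\gamma}\,(t-t_0)\Big)^{-\frac1\gamma} & \text{for }t\ge t_0,\end{cases}$$ where $$t_0=\max\left\{0,\ \frac{1}{C\,r\,R^N}\log\left(R^{\frac2\gamma}\,\|u_0\|_1^{-p}\,\|u_0\|_p^p\right)\right\}.$$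
   Context: $\|\cdot\|_q$ denotes the norm of $L^q(\mathbb{R}^N)$. The solution is the unique $u\in\mathcal{C}^1([0,+\infty),L^1(\mathbb{R}^N)\cap L^p(\mathbb{R}^N))$ satisfying the equation and the initial condition. The energy inequality defining the constant $C=C(N,p)$: for every measurable $J:\mathbb{R}^N\to[0,+\infty)$ with $J(z)\ge r$ for $|z|<R$ ($r,R>0$) and every $u\in L^1(\mathbb{R}^N)\cap L^p(\mathbb{R}^N)$, $$\mathcal{D}_p^J(u)\ge C\,r\,\min\left\{R^{N+2}\|u\|_1^{-p\gamma}\|u\|_p^{p(1+\gamma)},\,R^N\|u\|_p^p\right\},$$ where $$\mathcal{D}_p^J(u):=\frac p2\int_{\mathbb{R}^N}\int_{\mathbb{R}^N}J(x-y)(u(x)-u(y))\big(\phi_{p-1}(u(x))-\phi_{p-1}(u(y))\big)\,dx\,dy,\qquad \phi_q(s):=|s|^q\,\mathrm{sgn}(s).$$ *)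

theory Defs
  imports "HOL-Analysis.Analysis"
begin

definition Lp_space :: "real \<Rightarrow> ('a::euclidean_space \<Rightarrow> real) set" where
  "Lp_space q = {f. f \<in> borel_measurable lebesgue \<and> integrable lebesgue (\<lambda>x. \<bar>f x\<bar> powr q)}"

definition Lp_norm :: "real \<Rightarrow> ('a::euclidean_space \<Rightarrow> real) \<Rightarrow> real" where
  "Lp_norm q f = (\<integral>x. \<bar>f x\<bar> powr q \<partial>lebesgue) powr (1 / q)"

definition phi :: "real \<Rightarrow> real \<Rightarrow> real" where
  "phi q s = \<bar>s\<bar> powr q * sgn s"

text \<open>For nonnegative \<open>J\<close> and \<open>q \<ge> 1\<close> the integrand is nonnegative and the energy may be
  infinite, hence the values in \<^typ>\<open>ennreal\<close>.\<close>

definition energy :: "real \<Rightarrow> ('a::euclidean_space \<Rightarrow> real) \<Rightarrow> ('a \<Rightarrow> real) \<Rightarrow> ennreal" where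
  "energy p J u =
     ennreal (p / 2) *
     (\<integral>\<^sup>+x. (\<integral>\<^sup>+y. ennreal (J (x - y) * (u x - u y) * (phi (p - 1) (u x) - phi (p - 1) (u y)))
        \<partial>lebesgue) \<partial>lebesgue)"

text \<open>The Banach space \<open>L\<^sup>1 \<inter> L\<^sup>p\<close>, with its usual norm. Its elements are represented by functions,
  so equalities between elements are equalities almost everywhere.\<close>

definition L1p_space :: "real \<Rightarrow> ('a::euclidean_space \<Rightarrow> real) set" where
  "L1p_space p = Lp_space 1 \<inter> Lp_space p"

definition L1p_norm :: "real \<Rightarrow> ('a::euclidean_space \<Rightarrow> real) \<Rightarrow> real" where
  "L1p_norm p f = Lp_norm 1 f + Lp_norm p f"

text \<open>\<open>u\<close> is a \<open>C\<^sup>1\<close> curve from \<open>[0, \<infinity>)\<close> to \<open>L\<^sup>1 \<inter> L\<^sup>p\<close> whose strong derivative is \<open>v\<close>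
  (one-sided at \<open>0\<close>). The values of \<open>u\<close> and \<open>v\<close> at negative times are irrelevant.\<close>

definition C1_curve ::
    "real \<Rightarrow> (real \<Rightarrow> 'a::euclidean_space \<Rightarrow> real) \<Rightarrow> (real \<Rightarrow> 'a \<Rightarrow> real) \<Rightarrow> bool" where
  "C1_curve p u v \<longleftrightarrow>
     (\<forall>t\<ge>0. u t \<in> L1p_space p \<and> v t \<in> L1p_space p) \<and>
     (\<forall>t\<ge>0. ((\<lambda>s. L1p_norm p (\<lambda>x. (u s x - u t x) / (s - t) - v t x)) \<longlongrightarrow> 0)
              (at t within {0..})) \<and>
     (\<forall>t\<ge>0. ((\<lambda>s. L1p_norm p (\<lambda>x. v s x - v t x)) \<longlongrightarrow> 0) (at t within {0..}))"

text \<open>For \<open>J\<close> and \<open>u t\<close> in \<open>L\<^sup>1\<close> the integrand below is integrable for almost every \<open>x\<close>.\<close>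

definition is_solution ::
    "real \<Rightarrow> ('a::euclidean_space \<Rightarrow> real) \<Rightarrow> ('a \<Rightarrow> real) \<Rightarrow> (real \<Rightarrow> 'a \<Rightarrow> real) \<Rightarrow> bool" where
  "is_solution p J u0 u \<longleftrightarrow>
     (\<exists>v. C1_curve p u v \<and>
        (\<forall>t\<ge>0. AE x in lebesgue. v t x = (\<integral>y. J (x - y) * (u t y - u t x) \<partial>lebesgue))) \<and>
     (AE x in lebesgue. u 0 x = u0 x)"

end

theory Submission
  imports Defs
begin

text \<open>
  Write \<open>N\<close> for the dimension and \<open>\<phi>\<^sub>q\<close> for \<open>phi q\<close>.

  Energy inequality. Since \<open>J\<close> is at least \<open>r\<close> on the ball of radius \<open>R\<close>, it suffices to
  treat the indicator of that ball as kernel, and the elementary inequality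
  \<open>(\<phi>\<^bsub>p/2\<^esub>(a) - \<phi>\<^bsub>p/2\<^esub>(b))\<^sup>2 \<le> p (a - b) (\<phi>\<^bsub>p-1\<^esub>(a) - \<phi>\<^bsub>p-1\<^esub>(b))\<close> reduces the energy of \<open>w\<close> to
  the quadratic energy \<open>E\<^sub>R\<close> of \<open>f = \<phi>\<^bsub>p/2\<^esub>(w)\<close>. Splitting a shift into \<open>n\<close> equal steps gives
  \<open>E\<^bsub>n R\<^esub> \<le> n\<^bsup>N+2\<^esup> E\<^sub>R\<close> (\<open>ball_energy_scale_le\<close>). On a ball of radius \<open>L\<close> so large that its volume
  dominates the appropriate ratio of the two norms of \<open>w\<close>, Markov's inequality shows that
  around points carrying half of the mass of \<open>\<bar>w\<bar>\<^sup>p\<close> at least half of the ball has values less than half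
  as large, whence \<open>E\<^sub>L\<close> is at least a multiple of \<open>L\<^sup>N\<close> times the integral of \<open>\<bar>w\<bar>\<^sup>p\<close>
  (\<open>ball_energy_ge_of_large_ball\<close>). Taking \<open>L = n R\<close> with \<open>n\<close> minimal gives the claim
  (\<open>ball_energy_ge\<close>).

  Dissipation. Let \<open>B\<^sub>q(b, a) = \<bar>b\<bar>\<^sup>q - \<bar>a\<bar>\<^sup>q - q \<phi>\<^bsub>q-1\<^esub>(a) (b - a)\<close>, which is nonnegative by
  convexity. For an integrable kernel, symmetric or not, pairing the diffusion operator with
  \<open>- q \<phi>\<^bsub>q-1\<^esub>(u)\<close> gives the double integral of \<open>J(x - y) B\<^sub>q(u(y), u(x))\<close>
  (\<open>dissipation_eq_bregman\<close>). This is monotone in \<open>J\<close>, and for the indicator of a ball it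
  equals the energy, by symmetrization. So the dissipation is at least \<open>r\<close> times the energy
  of the ball, with the same constant as in the energy inequality.

  Decay. For a differentiable curve in \<open>L\<^sup>q\<close> with derivative \<open>v\<close>, convexity bounds the upper
  left Dini derivative of the integral of \<open>\<bar>u\<bar>\<^sup>q\<close> by that of \<open>q \<phi>\<^bsub>q-1\<^esub>(u) v\<close>
  (\<open>left_Dini_integral_powr\<close>). With \<open>q = 1\<close> the \<open>L\<^sup>1\<close> norm does not increase. With \<open>q = p\<close> the
  integral \<open>F\<close> of \<open>\<bar>u\<bar>\<^sup>p\<close> satisfies \<open>F' \<le> - \<kappa> min (F, A F\<^bsup>1+\<gamma>\<^esup>)\<close>, where \<open>\<kappa> = C r R\<^sup>N\<close> and
  \<open>A\<close> is \<open>R\<^sup>2\<close> times the power \<open>- p \<gamma>\<close> of the initial \<open>L\<^sup>1\<close> norm. Monotonicity of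
  \<open>ln F + \<kappa> t\<close> as long as \<open>A F\<^sup>\<gamma> > 1\<close>, and of \<open>\<gamma> \<kappa> A t - F\<^bsup>-\<gamma>\<^esup>\<close> afterwards, gives the bounds
  (\<open>decay_of_left_Dini\<close>).
\<close>

section \<open>Elementary inequalities\<close>

lemma powr_above_tangent:
  fixes a b q :: real
  assumes q: "q \<ge> 1"
  shows "\<bar>a\<bar> powr q + q * phi (q - 1) a * (b - a) \<le> \<bar>b\<bar> powr q"
proof -
  have pos: "a powr q + q * a powr (q - 1) * (c - a) \<le> \<bar>c\<bar> powr q" if a: "a > 0" for a c :: real
  proof (cases "c > 0")
    case True
    have "c powr q - a powr q \<ge> (q * a powr (q - 1)) * (c - a)"
      using True a q
      by (intro convex_on_imp_above_tangent[OF powr_convex])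
         (auto simp: interior_open intro!: derivative_eq_intros)
    then show ?thesis using True by simp
  next
    case False
    have "q * a powr (q - 1) * (c - a) \<le> 1 * a powr (q - 1) * (- a)"
    proof -
      have "1 * a powr (q - 1) * a \<le> q * a powr (q - 1) * (a - c)"
        using q a False by (intro mult_mono) auto
      then show ?thesis by (simp add: algebra_simps)
    qed
    also have "\<dots> = - (a powr q)"
      using a by (simp add: powr_diff)
    finally have "a powr q + q * a powr (q - 1) * (c - a) \<le> 0" by simp
    also have "\<dots> \<le> \<bar>c\<bar> powr q" by simp
    finally show ?thesis .
  qed
  consider "a = 0" | "a > 0" | "a < 0" by linarith
  then show ?thesis
  proof cases
    case 1 then show ?thesis by (simp add: phi_def)
  next
    case 2 then show ?thesis using pos[of a b] by (simp add: phi_def)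
  next
    case 3 then show ?thesis using pos[of "-a" "-b"] by (simp add: phi_def algebra_simps)
  qed
qed

lemma phi_mult_self: "phi (q - 1) a * a = \<bar>a\<bar> powr q"
  by (cases "a = 0") (auto simp: phi_def powr_diff sgn_if)

lemma phi_minus: "phi q (- a) = - phi q a"
  by (simp add: phi_def)

lemma phi_mono:
  assumes "q \<ge> 0" "a \<le> b"
  shows "phi q a \<le> phi q b"
proof -
  consider "0 \<le> a" | "a < 0" "0 < b" | "b \<le> 0" "a < 0" using assms by linarith
  then show ?thesis
  proof cases
    case 1 then show ?thesis using assms by (cases "a = 0") (auto simp: phi_def intro: powr_mono2)
  next
    case 2 then show ?thesis by (auto simp: phi_def intro: order_trans[of _ 0])
  next
    case 3 then show ?thesis using assms by (cases "b = 0") (auto simp: phi_def intro: powr_mono2)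
  qed
qed

lemma phi_energy_nonneg: "q \<ge> 0 \<Longrightarrow> 0 \<le> (a - b) * (phi q a - phi q b)"
  using phi_mono[of q a b] phi_mono[of q b a]
  by (cases "a \<le> b") (auto simp: mult_nonneg_nonneg mult_nonpos_nonpos)

lemma measurable_phi[measurable]: "phi q \<in> borel_measurable borel"
  unfolding phi_def by measurable

text \<open>The Stroock--Varopoulos inequality, with a non-optimal constant.\<close>

lemma phi_half_diff_squared_le:
  fixes a b p :: real
  assumes p: "p \<ge> 2"
  shows "(phi (p / 2) a - phi (p / 2) b)\<^sup>2 \<le> p * ((a - b) * (phi (p - 1) a - phi (p - 1) b))"
proof -
  have same: "(a powr (p/2) - b powr (p/2))\<^sup>2 \<le> p * ((a - b) * (a powr (p-1) - b powr (p-1)))"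
    if "0 < a" "0 \<le> b" "b \<le> a" for a b :: real
  proof -
    let ?A = "a powr (p/2)" and ?B = "b powr (p/2)" and ?D = "a powr (p/2 - 1)"
    have d: "?A - ?B \<ge> 0" using that p by (auto intro: powr_mono2)
    have "?A + p/2 * phi (p/2 - 1) a * (b - a) \<le> ?B"
      using powr_above_tangent[of "p/2" a b] that p by simp
    then have 1: "?A - ?B \<le> p/2 * ?D * (a - b)"
      using that by (simp add: phi_def field_simps)
    have "b powr (p - 1) \<le> ?D * ?B"
    proof -
      have "b powr (p - 1) = b powr (p/2 - 1) * ?B"
        using powr_add[of b "p/2 - 1" "p/2"] by simp
      also have "\<dots> \<le> ?D * ?B" using that p by (intro mult_right_mono powr_mono2) auto
      finally show ?thesis .
    qed
    moreover have "a powr (p - 1) = ?D * ?A"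
      using powr_add[of a "p/2 - 1" "p/2"] by simp
    ultimately have 2: "?D * (?A - ?B) \<le> a powr (p-1) - b powr (p-1)"
      by (simp add: algebra_simps)
    have "(?A - ?B)\<^sup>2 \<le> (p/2 * ?D * (a - b)) * (?A - ?B)"
      unfolding power2_eq_square using 1 d by (rule mult_right_mono)
    also have "\<dots> = (p/2 * (a - b)) * (?D * (?A - ?B))" by simp
    also have "\<dots> \<le> (p/2 * (a - b)) * (a powr (p-1) - b powr (p-1))"
      using 2 p that by (intro mult_left_mono) auto
    also have "\<dots> = p/2 * ((a - b) * (a powr (p-1) - b powr (p-1)))" by simp
    also have "\<dots> \<le> p * ((a - b) * (a powr (p-1) - b powr (p-1)))"
      using that p by (intro mult_right_mono mult_nonneg_nonneg) (auto intro: powr_mono2)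
    finally show ?thesis .
  qed
  have opp: "(a powr (p/2) + c powr (p/2))\<^sup>2 \<le> p * ((a + c) * (a powr (p-1) + c powr (p-1)))"
    if "0 < a" "0 < c" for a c :: real
  proof -
    have sq: "(x powr (p/2))\<^sup>2 = x * x powr (p - 1)" if "x > 0" for x :: real
      using that by (simp add: power2_eq_square powr_add[symmetric] powr_mult_base)
    have "(a powr (p/2) + c powr (p/2))\<^sup>2 \<le> 2 * ((a powr (p/2))\<^sup>2 + (c powr (p/2))\<^sup>2)"
      using sum_squares_bound[of "a powr (p/2)" "c powr (p/2)"] by (simp add: power2_sum)
    also have "\<dots> = 2 * (a * a powr (p-1) + c * c powr (p-1))"
      using sq that by simp
    also have "\<dots> \<le> 2 * ((a + c) * (a powr (p-1) + c powr (p-1)))"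
      using that by (simp add: algebra_simps)
    also have "\<dots> \<le> p * ((a + c) * (a powr (p-1) + c powr (p-1)))"
      using that p by (intro mult_right_mono) auto
    finally show ?thesis .
  qed
  \<comment> \<open>Swapping \<open>a\<close> and \<open>b\<close>, or changing both signs, leaves both sides unchanged, so the
    larger modulus may be taken first and positive.\<close>
  have main: "(phi (p/2) a - phi (p/2) b)\<^sup>2 \<le> p * ((a - b) * (phi (p-1) a - phi (p-1) b))"
    if "\<bar>b\<bar> \<le> a" for a b :: real
  proof -
    consider "a = 0" "b = 0" | "0 < a" "0 \<le> b" | "0 < a" "b < 0" using \<open>\<bar>b\<bar> \<le> a\<close> by linarith
    then show ?thesis
    proof cases
      case 1 then show ?thesis by simp
    next
      case 2 then show ?thesis using same[of a b] that by (cases "b = 0") (auto simp: phi_def)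
    next
      case 3 then show ?thesis using opp[of a "-b"] by (auto simp: phi_def)
    qed
  qed
  consider "\<bar>b\<bar> \<le> a" | "\<bar>b\<bar> \<le> - a" | "\<bar>a\<bar> \<le> b" | "\<bar>a\<bar> \<le> - b" by linarith
  then show ?thesis
  proof cases
    case 1 then show ?thesis by (rule main)
  next
    case 2 then show ?thesis using main[of "-b" "-a"] 
      by (simp add: phi_minus power2_commute algebra_simps)
  next
    case 3 then show ?thesis using main[of a b]
      by (simp add: power2_commute algebra_simps)
  next
    case 4 then show ?thesis using main[of "-a" "-b"]
      by (simp add: phi_minus power2_commute algebra_simps)
  qed
qed

lemma powr_le_phi_half_diff_squared:
  fixes a b p :: real
  assumes p: "p \<ge> 2" and ab: "\<bar>b\<bar> < \<bar>a\<bar> / 2"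
  shows "\<bar>a\<bar> powr p / 4 \<le> (phi (p / 2) a - phi (p / 2) b)\<^sup>2"
proof -
  let ?A = "\<bar>a\<bar> powr (p/2)"
  have a: "a \<noteq> 0" using ab by auto
  have "\<bar>b\<bar> powr (p/2) \<le> (\<bar>a\<bar> / 2) powr (p/2)"
    using ab p by (intro powr_mono2) auto
  also have "\<dots> = ?A / 2 powr (p/2)" by (simp add: powr_divide)
  also have "\<dots> \<le> ?A / 2 powr 1"
    using p by (intro divide_left_mono powr_mono) auto
  finally have "\<bar>phi (p/2) b\<bar> \<le> ?A / 2"
    by (simp add: phi_def abs_mult abs_sgn_eq)
  moreover have "\<bar>phi (p/2) a\<bar> = ?A" using a by (simp add: phi_def abs_mult abs_sgn_eq)
  ultimately have "?A / 2 \<le> \<bar>phi (p/2) a - phi (p/2) b\<bar>" by linarith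
  then have "(?A / 2)\<^sup>2 \<le> (phi (p/2) a - phi (p/2) b)\<^sup>2"
    by (metis abs_le_square_iff abs_of_nonneg divide_nonneg_nonneg powr_ge_zero zero_le_numeral)
  moreover have "(?A / 2)\<^sup>2 = \<bar>a\<bar> powr p / 4"
    by (simp add: power2_eq_square powr_add[symmetric])
  ultimately show ?thesis by simp
qed

text \<open>Young's inequality with a non-optimal constant, which also covers \<open>q = 1\<close>.\<close>

lemma phi_mult_le_Young:
  fixes a b q \<epsilon> :: real
  assumes "q \<ge> 1" "\<epsilon> > 0"
  shows "\<bar>phi (q - 1) a * b\<bar> \<le> \<epsilon> * \<bar>a\<bar> powr q + \<epsilon> powr (1 - q) * \<bar>b\<bar> powr q"
proof (cases "a = 0 \<or> b = 0")
  case True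
  then show ?thesis using assms by (auto simp: phi_def)
next
  case False
  have eq: "\<bar>phi (q - 1) a * b\<bar> = \<bar>a\<bar> powr (q - 1) * \<bar>b\<bar>"
    using False by (simp add: phi_def abs_mult abs_sgn_eq)
  show ?thesis
  proof (cases "\<bar>b\<bar> \<le> \<epsilon> * \<bar>a\<bar>")
    case True
    have "\<bar>a\<bar> powr (q - 1) * \<bar>b\<bar> \<le> \<bar>a\<bar> powr (q - 1) * (\<epsilon> * \<bar>a\<bar>)"
      using True by (intro mult_left_mono) auto
    also have "\<dots> = \<epsilon> * \<bar>a\<bar> powr q" using False by (simp add: powr_diff)
    finally show ?thesis using eq by (simp add: add_increasing2)
  next
    case b: False
    have "\<bar>a\<bar> powr (q - 1) * \<bar>b\<bar> \<le> (\<bar>b\<bar> / \<epsilon>) powr (q - 1) * \<bar>b\<bar>"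
      using b assms by (intro mult_right_mono powr_mono2) (auto simp: field_simps)
    also have "\<dots> = \<epsilon> powr (1 - q) * \<bar>b\<bar> powr q"
      using False assms by (simp add: powr_divide powr_diff)
    finally show ?thesis using eq assms by (simp add: add_increasing)
  qed
qed

text \<open>The factor of \<open>\<bar>a\<bar>\<^sup>q\<close> can be taken as close to \<open>1\<close> as desired.\<close>

lemma powr_add_le:
  fixes a b q \<delta> :: real
  assumes "q \<ge> 0" "\<delta> > 0"
  shows "\<bar>a + b\<bar> powr q \<le> (1 + \<delta>) powr q * \<bar>a\<bar> powr q + (1 + 1 / \<delta>) powr q * \<bar>b\<bar> powr q"
proof (cases "\<bar>b\<bar> \<le> \<delta> * \<bar>a\<bar>")
  case True
  have "\<bar>a + b\<bar> powr q \<le> ((1 + \<delta>) * \<bar>a\<bar>) powr q"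
    using True assms by (intro powr_mono2) (auto simp: algebra_simps)
  also have "\<dots> = (1 + \<delta>) powr q * \<bar>a\<bar> powr q" using assms by (simp add: powr_mult)
  finally show ?thesis by (simp add: add_increasing2)
next
  case False
  have "\<bar>a\<bar> \<le> \<bar>b\<bar> / \<delta>" using False assms by (simp add: field_simps)
  then have "\<bar>a + b\<bar> powr q \<le> ((1 + 1 / \<delta>) * \<bar>b\<bar>) powr q"
    using assms by (intro powr_mono2) (auto simp: algebra_simps)
  also have "\<dots> = (1 + 1 / \<delta>) powr q * \<bar>b\<bar> powr q" using assms by (simp add: powr_mult)
  finally show ?thesis by (simp add: add_increasing)
qed

section \<open>Translations, dilations and reflections\<close>

lemma nn_integral_lborel_translation:
  fixes f :: "'a::euclidean_space \<Rightarrow> ennreal"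
  assumes [measurable]: "f \<in> borel_measurable borel"
  shows "(\<integral>\<^sup>+x. f (c + x) \<partial>lborel) = (\<integral>\<^sup>+x. f x \<partial>lborel)"
proof -
  have "(\<integral>\<^sup>+x. f x \<partial>lborel) = (\<integral>\<^sup>+x. f x \<partial>distr lborel borel ((+) c))"
    by (simp add: lborel_distr_plus)
  also have "\<dots> = (\<integral>\<^sup>+x. f (c + x) \<partial>lborel)"
    by (subst nn_integral_distr) auto
  finally show ?thesis by simp
qed

lemma nn_integral_lborel_dilation:
  fixes f :: "'a::euclidean_space \<Rightarrow> ennreal"
  assumes [measurable]: "f \<in> borel_measurable borel" and c: "c \<noteq> 0"
  shows "(\<integral>\<^sup>+x. f x \<partial>lborel) = ennreal (\<bar>c\<bar> ^ DIM('a)) * (\<integral>\<^sup>+x. f (c *\<^sub>R x) \<partial>lborel)"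
proof -
  have "(\<integral>\<^sup>+x. f x \<partial>lborel) =
      (\<integral>\<^sup>+x. f x \<partial>density (distr lborel borel (\<lambda>x. 0 + c *\<^sub>R x)) (\<lambda>_. ennreal (\<bar>c\<bar> ^ DIM('a))))"
    by (subst lborel_affine[OF c, of 0]) simp
  also have "\<dots> = (\<integral>\<^sup>+x. ennreal (\<bar>c\<bar> ^ DIM('a)) * f (c *\<^sub>R x) \<partial>lborel)"
    by (subst nn_integral_density) (auto simp: nn_integral_distr)
  finally show ?thesis by (simp add: nn_integral_cmult)
qed

lemma nn_integral_lborel_reflection:
  fixes f :: "'a::euclidean_space \<Rightarrow> ennreal"
  assumes [measurable]: "f \<in> borel_measurable borel"
  shows "(\<integral>\<^sup>+y. f (c - y) \<partial>lborel) = (\<integral>\<^sup>+y. f y \<partial>lborel)"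
proof -
  have "(\<integral>\<^sup>+y. f y \<partial>lborel) = (\<integral>\<^sup>+y. f (- y) \<partial>lborel)"
    using nn_integral_lborel_dilation[of f "-1"] by simp
  also have "\<dots> = (\<integral>\<^sup>+y. f (- (- c + y)) \<partial>lborel)"
    by (subst nn_integral_lborel_translation[of "\<lambda>y. f (- y)"]) auto
  finally show ?thesis by simp
qed

lemma AE_lborel_reflection:
  fixes c :: "'a::euclidean_space"
  assumes "AE z in lborel. P z"
  shows "AE y in lborel. P (c - y)"
proof -
  obtain S where S: "S \<in> null_sets lborel" "{z. \<not> P z} \<subseteq> S"
    using assms unfolding eventually_ae_filter by auto
  then have [measurable]: "S \<in> sets borel" by auto
  define T where "T = {y. c - y \<in> S}"
  have [measurable]: "T \<in> sets borel" unfolding T_def by measurable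
  have "emeasure lborel T = (\<integral>\<^sup>+y. indicator T y \<partial>lborel)" by simp
  also have "\<dots> = (\<integral>\<^sup>+y. indicator S (c - y) \<partial>lborel)"
    by (intro nn_integral_cong) (auto simp: T_def split: split_indicator)
  also have "\<dots> = (\<integral>\<^sup>+y. indicator S y \<partial>lborel)"
    by (rule nn_integral_lborel_reflection) simp
  also have "\<dots> = 0" using S by auto
  finally have "T \<in> null_sets lborel" by (auto intro!: null_setsI)
  moreover have "{y. \<not> P (c - y)} \<subseteq> T" using S by (auto simp: T_def)
  ultimately show ?thesis unfolding eventually_ae_filter by auto
qed

lemma borel_measurable_ball[measurable]:
  fixes c :: "'a::metric_space"
  shows "ball c r \<in> sets borel"
  by simp

section \<open>The quadratic energy at different scales\<close>

text \<open>The nonlocal Dirichlet energy of \<open>f\<close> with the indicator of a ball as kernel.\<close>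

definition ball_energy :: "real \<Rightarrow> ('a::euclidean_space \<Rightarrow> real) \<Rightarrow> ennreal" where
  "ball_energy \<rho> f =
     (\<integral>\<^sup>+x. (\<integral>\<^sup>+y. ennreal (indicator (ball 0 \<rho>) (x - y) * (f x - f y)\<^sup>2) \<partial>lborel) \<partial>lborel)"

text \<open>The squared \<open>L\<^sup>2\<close> modulus of continuity of \<open>f\<close>.\<close>

definition shift_energy :: "('a::euclidean_space \<Rightarrow> real) \<Rightarrow> 'a \<Rightarrow> ennreal" where
  "shift_energy f z = (\<integral>\<^sup>+x. ennreal ((f x - f (x + z))\<^sup>2) \<partial>lborel)"

lemma ball_energy_eq_shift_energy:
  fixes f :: "'a::euclidean_space \<Rightarrow> real"
  assumes [measurable]: "f \<in> borel_measurable borel"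
  shows "ball_energy \<rho> f = (\<integral>\<^sup>+z. indicator (ball 0 \<rho>) z * shift_energy f z \<partial>lborel)"
proof -
  have "ball_energy \<rho> f =
      (\<integral>\<^sup>+x. (\<integral>\<^sup>+z. ennreal (indicator (ball 0 \<rho>) z * (f x - f (x + z))\<^sup>2) \<partial>lborel) \<partial>lborel)"
    unfolding ball_energy_def
  proof (rule nn_integral_cong)
    fix x :: 'a
    show "(\<integral>\<^sup>+y. ennreal (indicator (ball 0 \<rho>) (x - y) * (f x - f y)\<^sup>2) \<partial>lborel) =
      (\<integral>\<^sup>+z. ennreal (indicator (ball 0 \<rho>) z * (f x - f (x + z))\<^sup>2) \<partial>lborel)"
      using nn_integral_lborel_translation[of
          "\<lambda>y. ennreal (indicator (ball 0 \<rho>) (x - y) * (f x - f y)\<^sup>2)" x]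
      by (simp add: indicator_def)
  qed
  also have "\<dots> =
      (\<integral>\<^sup>+z. (\<integral>\<^sup>+x. ennreal (indicator (ball 0 \<rho>) z * (f x - f (x + z))\<^sup>2) \<partial>lborel) \<partial>lborel)"
    by (rule lborel_pair.Fubini') measurable
  also have "\<dots> = (\<integral>\<^sup>+z. indicator (ball 0 \<rho>) z * shift_energy f z \<partial>lborel)"
    unfolding shift_energy_def by (intro nn_integral_cong) (auto simp: indicator_def)
  finally show ?thesis .
qed

lemma sum_squared_le:
  fixes g :: "nat \<Rightarrow> real"
  shows "(\<Sum>k<n. g k)\<^sup>2 \<le> real n * (\<Sum>k<n. (g k)\<^sup>2)"
  using Cauchy_Schwarz_ineq_sum[of "\<lambda>_. 1" g "{..<n}"] by simp

text \<open>A shift by \<open>n z\<close> is a chain of \<open>n\<close> shifts by \<open>z\<close>.\<close>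

lemma shift_energy_scaleR_le:
  fixes f :: "'a::euclidean_space \<Rightarrow> real"
  assumes [measurable]: "f \<in> borel_measurable borel"
  shows "shift_energy f (real n *\<^sub>R z) \<le> ennreal ((real n)\<^sup>2) * shift_energy f z"
proof -
  let ?g = "\<lambda>k x. f (x + real k *\<^sub>R z) - f (x + real (Suc k) *\<^sub>R z)"
  have "shift_energy f (real n *\<^sub>R z) \<le> (\<integral>\<^sup>+x. ennreal (real n) * (\<Sum>k<n. ennreal ((?g k x)\<^sup>2)) \<partial>lborel)"
    unfolding shift_energy_def
  proof (intro nn_integral_mono)
    fix x :: 'a
    have "f x - f (x + real n *\<^sub>R z) = (\<Sum>k<n. ?g k x)"
      by (subst sum_lessThan_telescope') simp
    then have "(f x - f (x + real n *\<^sub>R z))\<^sup>2 \<le> real n * (\<Sum>k<n. (?g k x)\<^sup>2)"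
      using sum_squared_le[of "\<lambda>k. ?g k x" n] by simp
    then have "ennreal ((f x - f (x + real n *\<^sub>R z))\<^sup>2) \<le> ennreal (real n * (\<Sum>k<n. (?g k x)\<^sup>2))"
      by (rule ennreal_leI)
    also have "\<dots> = ennreal (real n) * (\<Sum>k<n. ennreal ((?g k x)\<^sup>2))"
      by (simp only: ennreal_mult' sum_ennreal zero_le_power2 of_nat_0_le_iff)
    finally show "ennreal ((f x - f (x + real n *\<^sub>R z))\<^sup>2) \<le>
        ennreal (real n) * (\<Sum>k<n. ennreal ((?g k x)\<^sup>2))" .
  qed
  also have "\<dots> = ennreal (real n) * (\<Sum>k<n. \<integral>\<^sup>+x. ennreal ((?g k x)\<^sup>2) \<partial>lborel)"
    by (simp add: nn_integral_cmult nn_integral_sum del: sum_ennreal)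
  also have "(\<Sum>k<n. \<integral>\<^sup>+x. ennreal ((?g k x)\<^sup>2) \<partial>lborel) = (\<Sum>k<n. shift_energy f z)"
  proof (rule sum.cong[OF refl])
    fix k
    have "(\<integral>\<^sup>+x. ennreal ((?g k x)\<^sup>2) \<partial>lborel) =
        (\<integral>\<^sup>+x. ennreal ((f (real k *\<^sub>R z + x) - f (real k *\<^sub>R z + x + z))\<^sup>2) \<partial>lborel)"
      by (simp add: algebra_simps)
    also have "\<dots> = shift_energy f z"
      unfolding shift_energy_def
      by (rule nn_integral_lborel_translation[of "\<lambda>x. ennreal ((f x - f (x + z))\<^sup>2)"]) measurable
    finally show "(\<integral>\<^sup>+x. ennreal ((?g k x)\<^sup>2) \<partial>lborel) = shift_energy f z" .
  qed
  also have "ennreal (real n) * (\<Sum>k<n. shift_energy f z) = ennreal ((real n)\<^sup>2) * shift_energy f z"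
    by (simp add: power2_eq_square ennreal_mult' mult.assoc ennreal_of_nat_eq_real_of_nat)
  finally show ?thesis .
qed

text \<open>The factor consists of \<open>n\<^sup>N\<close> from the dilation of the ball and \<open>n\<^sup>2\<close> from the chain of shifts.\<close>

lemma ball_energy_scale_le:
  fixes f :: "'a::euclidean_space \<Rightarrow> real"
  assumes f[measurable]: "f \<in> borel_measurable borel" and n: "n > 0"
  shows "ball_energy (real n * \<rho>) f \<le> ennreal (real n ^ (DIM('a) + 2)) * ball_energy \<rho> f"
proof -
  have [measurable]: "shift_energy f \<in> borel_measurable borel"
    unfolding shift_energy_def by measurable
  have "ball_energy (real n * \<rho>) f =
      (\<integral>\<^sup>+z. indicator (ball 0 (real n * \<rho>)) z * shift_energy f z \<partial>lborel)"
    by (rule ball_energy_eq_shift_energy) fact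
  also have "\<dots> = ennreal (\<bar>real n\<bar> ^ DIM('a)) *
      (\<integral>\<^sup>+z. indicator (ball 0 (real n * \<rho>)) (real n *\<^sub>R z) * shift_energy f (real n *\<^sub>R z) \<partial>lborel)"
    using n by (intro nn_integral_lborel_dilation; (measurable | simp))
  also have "\<dots> \<le> ennreal (\<bar>real n\<bar> ^ DIM('a)) *
      (\<integral>\<^sup>+z. ennreal ((real n)\<^sup>2) * (indicator (ball 0 \<rho>) z * shift_energy f z) \<partial>lborel)"
  proof (intro mult_left_mono nn_integral_mono)
    fix z :: 'a
    have "indicator (ball 0 (real n * \<rho>)) (real n *\<^sub>R z) = (indicator (ball 0 \<rho>) z :: ennreal)"
      using n by (simp add: indicator_def)
    then show "indicator (ball 0 (real n * \<rho>)) (real n *\<^sub>R z) * shift_energy f (real n *\<^sub>R z) \<le>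
        ennreal ((real n)\<^sup>2) * (indicator (ball 0 \<rho>) z * shift_energy f z)"
      using shift_energy_scaleR_le[OF f, of n z] by (auto simp: indicator_def)
  qed auto
  also have "\<dots> = ennreal (\<bar>real n\<bar> ^ DIM('a)) * (ennreal ((real n)\<^sup>2) * ball_energy \<rho> f)"
    by (simp add: nn_integral_cmult ball_energy_eq_shift_energy)
  also have "\<dots> = ennreal (real n ^ (DIM('a) + 2)) * ball_energy \<rho> f"
    by (subst power_add, subst ennreal_mult) (auto simp: mult.assoc simp del: ennreal_power)
  finally show ?thesis .
qed

lemma ennreal_half_le:
  assumes "ennreal a \<le> ennreal (a / 2) + X" "a \<ge> 0"
  shows "ennreal (a / 2) \<le> X"
proof -
  have "ennreal a = ennreal (a / 2 + a / 2)" by (simp only: field_sum_of_halves)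
  also have "\<dots> = ennreal (a / 2) + ennreal (a / 2)"
    using assms(2) by (intro ennreal_plus) auto
  finally show ?thesis
    using assms(1) by (metis ennreal_add_left_cancel_le ennreal_neq_top infinity_ennreal_def)
qed

text \<open>By Markov's inequality, around every point where \<open>\<bar>w\<bar>\<close> is at least four times the \<open>L\<^sup>1\<close> norm
  divided by the volume of the ball, at least half of the ball carries values less than half as
  large. The other points contribute at most half of the integral of \<open>\<bar>w\<bar>\<^sup>p\<close> if the ball is large
  enough.\<close>

lemma ball_energy_ge_of_large_ball:
  fixes w :: "'a::euclidean_space \<Rightarrow> real"
  assumes w[measurable]: "w \<in> borel_measurable borel" and p: "p \<ge> 2"
    and M1: "(\<integral>\<^sup>+x. ennreal \<bar>w x\<bar> \<partial>lborel) = ennreal M1" "M1 > 0"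
    and Mp: "(\<integral>\<^sup>+x. ennreal (\<bar>w x\<bar> powr p) \<partial>lborel) = ennreal Mp" "Mp > 0"
    and L: "L > 0"
    and large: "2 * (4 / measure lborel (ball (0::'a) L)) powr (p - 1) * M1 powr p \<le> Mp"
  shows "ennreal (measure lborel (ball (0::'a) L) / 16 * Mp) \<le> ball_energy L (\<lambda>x. phi (p / 2) (w x))"
proof -
  define V where "V = measure lborel (ball (0::'a) L)"
  have V: "V > 0" unfolding V_def using L by (rule content_ball_pos)
  have emV: "emeasure lborel (ball x L) = ennreal V" for x :: 'a
    unfolding V_def using content_ball_conv_unit_ball[of L x] content_ball_conv_unit_ball[of L "0::'a"]
      emeasure_lborel_ball_finite[of x L] L
    by (subst emeasure_eq_ennreal_measure) auto
  \<comment> \<open>Above the level \<open>l\<close>, Markov's inequality leaves half of the ball to the small values.\<close>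
  define l where "l = 4 * M1 / V"
  have l: "l > 0" using V M1 by (simp add: l_def)
  have inner: "ennreal (V / 8 * \<bar>w x\<bar> powr p) \<le>
      (\<integral>\<^sup>+y. ennreal (indicator (ball 0 L) (x - y) * (phi (p/2) (w x) - phi (p/2) (w y))\<^sup>2) \<partial>lborel)"
    if x: "\<bar>w x\<bar> \<ge> l" for x
  proof -
    define G where "G = {y \<in> ball x L. \<bar>w y\<bar> < \<bar>w x\<bar> / 2}"
    define H where "H = {y \<in> ball x L. 1 \<le> ennreal (2 / \<bar>w x\<bar>) * ennreal \<bar>w y\<bar>}"
    have [measurable]: "G \<in> sets borel" "H \<in> sets borel" unfolding G_def H_def by measurable
    have wx: "\<bar>w x\<bar> > 0" using x l by simp
    have "emeasure lborel H \<le> ennreal (2 / \<bar>w x\<bar>) * (\<integral>\<^sup>+y. ennreal \<bar>w y\<bar> * indicator (ball x L) y \<partial>lborel)"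
      unfolding H_def by (rule nn_integral_Markov_inequality; measurable)
    also have "\<dots> \<le> ennreal (2 / \<bar>w x\<bar>) * (\<integral>\<^sup>+y. ennreal \<bar>w y\<bar> \<partial>lborel)"
      by (intro mult_left_mono nn_integral_mono) (auto simp: indicator_def)
    also have "\<dots> = ennreal (2 / \<bar>w x\<bar> * M1)"
      unfolding M1(1) using M1(2) by (intro ennreal_mult[symmetric]) auto
    also have "\<dots> \<le> ennreal (V / 2)"
    proof (rule ennreal_leI)
      have "4 * M1 \<le> V * \<bar>w x\<bar>" using x V by (simp add: l_def field_simps)
      then show "2 / \<bar>w x\<bar> * M1 \<le> V / 2" using wx by (simp add: field_simps)
    qed
    finally have H: "emeasure lborel H \<le> ennreal (V / 2)" .
    have "ball x L \<subseteq> G \<union> H"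
      unfolding G_def H_def using wx by (auto simp: ennreal_mult'[symmetric] ennreal_le_1 simp flip: ennreal_1)
    then have "emeasure lborel (ball x L) \<le> emeasure lborel (G \<union> H)"
      by (intro emeasure_mono) auto
    also have "\<dots> \<le> emeasure lborel G + emeasure lborel H"
      by (intro emeasure_subadditive) auto
    also have "\<dots> \<le> emeasure lborel G + ennreal (V / 2)" using H by (rule add_left_mono)
    finally have "ennreal V \<le> ennreal (V / 2) + emeasure lborel G"
      unfolding emV add.commute[of "emeasure lborel G"] .
    then have G: "ennreal (V / 2) \<le> emeasure lborel G"
      using V by (intro ennreal_half_le) auto
    have "ennreal (V / 8 * \<bar>w x\<bar> powr p) = ennreal (\<bar>w x\<bar> powr p / 4) * ennreal (V / 2)"
      using V by (subst ennreal_mult'[symmetric]) (auto simp: field_simps)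
    also have "\<dots> \<le> ennreal (\<bar>w x\<bar> powr p / 4) * emeasure lborel G"
      using G by (intro mult_left_mono) auto
    also have "\<dots> = (\<integral>\<^sup>+y. ennreal (\<bar>w x\<bar> powr p / 4) * indicator G y \<partial>lborel)"
      by (simp add: nn_integral_cmult_indicator)
    also have "\<dots> \<le> (\<integral>\<^sup>+y. ennreal (indicator (ball 0 L) (x - y) * (phi (p/2) (w x) - phi (p/2) (w y))\<^sup>2) \<partial>lborel)"
      using powr_le_phi_half_diff_squared[OF p]
      by (intro nn_integral_mono) (auto simp: G_def indicator_def dist_norm norm_minus_commute intro!: ennreal_leI)
    finally show ?thesis .
  qed
  have low: "(\<integral>\<^sup>+x. ennreal (\<bar>w x\<bar> powr p) * indicator {x. \<bar>w x\<bar> < l} x \<partial>lborel) \<le> ennreal (Mp / 2)"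
  proof -
    have "(\<integral>\<^sup>+x. ennreal (\<bar>w x\<bar> powr p) * indicator {x. \<bar>w x\<bar> < l} x \<partial>lborel)
        \<le> (\<integral>\<^sup>+x. ennreal (l powr (p - 1)) * ennreal \<bar>w x\<bar> \<partial>lborel)"
    proof (intro nn_integral_mono)
      fix x
      show "ennreal (\<bar>w x\<bar> powr p) * indicator {x. \<bar>w x\<bar> < l} x \<le> ennreal (l powr (p - 1)) * ennreal \<bar>w x\<bar>"
      proof (cases "\<bar>w x\<bar> < l")
        case True
        have "\<bar>w x\<bar> powr p = \<bar>w x\<bar> powr (p - 1) * \<bar>w x\<bar>" by (cases "w x = 0") (auto simp: powr_diff)
        also have "\<dots> \<le> l powr (p - 1) * \<bar>w x\<bar>"
          using True p by (intro mult_right_mono powr_mono2) auto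
        finally show ?thesis using True by (simp add: ennreal_mult'[symmetric] ennreal_leI)
      qed simp
    qed
    also have "\<dots> = ennreal (l powr (p - 1) * M1)"
      using M1 by (simp add: nn_integral_cmult ennreal_mult')
    also have "\<dots> \<le> ennreal (Mp / 2)"
    proof (rule ennreal_leI)
      have "l powr (p - 1) * M1 = (4 / V) powr (p - 1) * (M1 powr (p - 1) * M1)"
        using V M1 by (simp add: l_def powr_mult powr_divide)
      also have "M1 powr (p - 1) * M1 = M1 powr p" using M1 by (simp add: powr_diff)
      finally show "l powr (p - 1) * M1 \<le> Mp / 2" using large by (simp add: V_def)
    qed
    finally show ?thesis .
  qed
  define P where "P = (\<integral>\<^sup>+x. ennreal (\<bar>w x\<bar> powr p) * indicator {x. l \<le> \<bar>w x\<bar>} x \<partial>lborel)"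
  have "ennreal Mp = (\<integral>\<^sup>+x. ennreal (\<bar>w x\<bar> powr p) * indicator {x. \<bar>w x\<bar> < l} x
        + ennreal (\<bar>w x\<bar> powr p) * indicator {x. l \<le> \<bar>w x\<bar>} x \<partial>lborel)"
    unfolding Mp(1)[symmetric] by (intro nn_integral_cong) (auto simp: indicator_def)
  also have "\<dots> = (\<integral>\<^sup>+x. ennreal (\<bar>w x\<bar> powr p) * indicator {x. \<bar>w x\<bar> < l} x \<partial>lborel) + P"
    unfolding P_def by (rule nn_integral_add) auto
  also have "\<dots> \<le> ennreal (Mp / 2) + P" using low by (rule add_right_mono)
  finally have P: "ennreal (Mp / 2) \<le> P"
    using Mp by (intro ennreal_half_le) auto
  have "ennreal (V / 16 * Mp) = ennreal (V / 8) * ennreal (Mp / 2)"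
    using V Mp by (subst ennreal_mult'[symmetric]) (auto simp: field_simps)
  also have "\<dots> \<le> ennreal (V / 8) * P" using P by (intro mult_left_mono) auto
  also have "\<dots> = (\<integral>\<^sup>+x. ennreal (V / 8 * \<bar>w x\<bar> powr p) * indicator {x. l \<le> \<bar>w x\<bar>} x \<partial>lborel)"
    unfolding P_def using V
    by (subst nn_integral_cmult[symmetric])
       (auto intro!: nn_integral_cong simp: ennreal_mult'[symmetric] split: split_indicator)
  also have "\<dots> \<le> ball_energy L (\<lambda>x. phi (p / 2) (w x))"
    unfolding ball_energy_def using inner by (intro nn_integral_mono) (auto simp: indicator_def)
  finally show ?thesis by (simp add: V_def)
qed

section \<open>The energy inequality\<close>

text \<open>An admissible value of the constant in the energy inequality, for \<open>N = DIM('a)\<close>. The two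
  entries of the minimum come from the two terms of the minimum in that inequality. The type
  argument only carries the dimension.\<close>

definition energy_const :: "'a::euclidean_space itself \<Rightarrow> real \<Rightarrow> real" where
  "energy_const _ p =
     (let \<omega> = measure lborel (ball (0::'a) 1); N = real DIM('a); \<gamma> = 2 / (N * (p - 1))
      in min (\<omega> / 32) (\<omega> / 128 * (\<omega> / 4) powr (2 / N) * 2 powr (- \<gamma>)))"

lemma energy_const_pos: "energy_const TYPE('a::euclidean_space) p > 0"
  using content_ball_pos[of 1 "0::'a"] by (simp add: energy_const_def Let_def)

text \<open>The lower bound at the scale \<open>n R\<close> is transported to the scale \<open>R\<close>, where \<open>n\<close> is the least
  positive integer for which the ball of radius \<open>n R\<close> is large enough. The two terms of the
  minimum correspond to \<open>n = 1\<close> and to \<open>n > 1\<close>.\<close>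

lemma ball_energy_ge:
  fixes w :: "'a::euclidean_space \<Rightarrow> real" and p \<gamma> :: real
  defines "\<gamma> \<equiv> 2 / (real DIM('a) * (p - 1))"
  assumes w[measurable]: "w \<in> borel_measurable borel" and p: "p \<ge> 2"
    and M1: "(\<integral>\<^sup>+x. ennreal \<bar>w x\<bar> \<partial>lborel) = ennreal M1" "M1 > 0"
    and Mp: "(\<integral>\<^sup>+x. ennreal (\<bar>w x\<bar> powr p) \<partial>lborel) = ennreal Mp" "Mp > 0"
    and R: "R > 0"
  shows "ennreal (2 * energy_const TYPE('a) p *
      min (R ^ (DIM('a) + 2) * M1 powr (- (p * \<gamma>)) * Mp powr (1 + \<gamma>)) (R ^ DIM('a) * Mp))
    \<le> ball_energy R (\<lambda>x. phi (p / 2) (w x))"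
proof -
  define N where "N = DIM('a)"
  have N: "N > 0" unfolding N_def by simp
  define \<omega> where "\<omega> = measure lborel (ball (0::'a) 1)"
  have \<omega>: "\<omega> > 0" unfolding \<omega>_def by (rule content_ball_pos) simp
  \<comment> \<open>\<open>Vs\<close> is the volume required in the large-ball estimate and \<open>Ls\<close> the corresponding radius.\<close>
  define Q where "Q = 2 * M1 powr p / Mp"
  have Q: "Q > 0" using M1 Mp by (simp add: Q_def)
  define Vs where "Vs = 4 * Q powr (1 / (p - 1))"
  define Ls where "Ls = (Vs / \<omega>) powr (1 / real N)"
  have Vs: "Vs > 0" using Q by (simp add: Vs_def)
  have Ls: "Ls > 0" using Vs \<omega> by (simp add: Ls_def)
  define n where "n = max 1 (nat \<lceil>Ls / R\<rceil>)"
  have n: "n > 0" by (simp add: n_def)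
  define L where "L = real n * R"
  have L: "L > 0" using n R by (simp add: L_def)
  have "Ls / R \<le> real n" unfolding n_def by linarith
  then have LsL: "Ls \<le> L" using R by (simp add: L_def field_simps)
  define V where "V = measure lborel (ball (0::'a) L)"
  have V_eq: "V = L ^ N * \<omega>"
    unfolding V_def N_def \<omega>_def using L by (intro content_ball_conv_unit_ball) simp
  have "Vs = Ls ^ N * \<omega>"
    using Vs \<omega> N by (simp add: Ls_def powr_power)
  also have "\<dots> \<le> V" unfolding V_eq using LsL Ls \<omega> by (intro mult_right_mono power_mono) auto
  finally have VsV: "Vs \<le> V" .
  have "2 * (4 / V) powr (p - 1) * M1 powr p \<le> 2 * (4 / Vs) powr (p - 1) * M1 powr p"
    using VsV Vs p by (intro mult_right_mono mult_left_mono powr_mono2 divide_left_mono) auto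
  also have "(4 / Vs) powr (p - 1) = 1 / Q"
    using Q p by (simp add: Vs_def powr_divide powr_powr)
  also have "2 * (1 / Q) * M1 powr p = Mp"
    using M1 Mp by (simp add: Q_def)
  finally have large: "2 * (4 / V) powr (p - 1) * M1 powr p \<le> Mp" .
  define X where "X = R ^ N * \<omega> / 16 * Mp / (real n)\<^sup>2"
  have X: "X \<ge> 0" unfolding X_def using R \<omega> Mp by simp
  have "real n ^ (N + 2) * X = V / 16 * Mp"
    using n by (simp add: V_eq L_def X_def power_add power_mult_distrib power2_eq_square)
  then have "ennreal (real n ^ (N + 2)) * ennreal X = ennreal (V / 16 * Mp)"
    using X by (metis ennreal_mult of_nat_0_le_iff zero_le_power)
  also have "\<dots> \<le> ball_energy L (\<lambda>x. phi (p / 2) (w x))"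
    unfolding V_def by (rule ball_energy_ge_of_large_ball[OF w p M1 Mp L large[unfolded V_def]])
  also have "\<dots> \<le> ennreal (real n ^ (N + 2)) * ball_energy R (\<lambda>x. phi (p / 2) (w x))"
    unfolding L_def N_def by (rule ball_energy_scale_le[OF _ n]) measurable
  finally have "ennreal X \<le> ball_energy R (\<lambda>x. phi (p / 2) (w x))"
    using n by (subst (asm) ennreal_mult_le_mult_iff) auto
  moreover have "2 * energy_const TYPE('a) p *
      min (R ^ (N + 2) * M1 powr (- (p * \<gamma>)) * Mp powr (1 + \<gamma>)) (R ^ N * Mp) \<le> X"
  proof -
    define A where "A = R ^ (N + 2) * M1 powr (- (p * \<gamma>)) * Mp powr (1 + \<gamma>)"
    define B where "B = R ^ N * Mp"
    define c where "c = energy_const TYPE('a) p"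
    define d where "d = \<omega> / 128 * (\<omega> / 4) powr (2 / real N) * 2 powr (- \<gamma>)"
    have c: "c \<le> \<omega> / 32" "c \<le> d"
      unfolding c_def d_def energy_const_def Let_def \<omega>_def N_def \<gamma>_def by auto
    have c0: "c > 0" unfolding c_def by (rule energy_const_pos)
    have AB: "A > 0" "B > 0" using R M1 Mp by (auto simp: A_def B_def)
    show ?thesis
    proof (cases "n = 1")
      case True
      have "2 * c * min A B \<le> 2 * (\<omega> / 32) * B"
        using c c0 AB by (intro mult_mono) auto
      also have "\<dots> = X" using True by (simp add: X_def B_def)
      finally show ?thesis by (simp add: A_def B_def c_def)
    next
      case False
      then have n2: "n \<ge> 2" "n = nat \<lceil>Ls / R\<rceil>" using n by (auto simp: n_def max_def split: if_splits)
      have "real n < Ls / R + 1" using n2 by linarith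
      moreover have "Ls / R > 1" using calculation n2 by linarith
      ultimately have "real n \<le> 2 * (Ls / R)" by linarith
      then have "(real n)\<^sup>2 \<le> (2 * (Ls / R))\<^sup>2" by (intro power_mono) auto
      then have n_le: "(real n)\<^sup>2 \<le> 4 * Ls\<^sup>2 / R\<^sup>2" by (simp add: power_mult_distrib power_divide)
      have "Ls\<^sup>2 = (Vs / \<omega>) powr (2 / real N)"
        using Vs \<omega> by (simp add: Ls_def powr_power)
      also have "\<dots> = (4 / \<omega>) powr (2 / real N) * (Q powr (1 / (p - 1))) powr (2 / real N)"
        using \<omega> Q by (simp add: Vs_def powr_mult powr_divide)
      also have "(Q powr (1 / (p - 1))) powr (2 / real N) = Q powr \<gamma>"
        by (simp add: powr_powr \<gamma>_def N_def mult.commute)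
      finally have "1 / Ls\<^sup>2 = 1 / ((4 / \<omega>) powr (2 / real N) * Q powr \<gamma>)" by simp
      also have "\<dots> = (\<omega> / 4) powr (2 / real N) * (1 / Q) powr \<gamma>"
      proof -
        have e: "1 / (a * b) = inverse a * inverse b" for a b :: real
          by (simp add: divide_inverse)
        have "(\<omega> / 4) powr (2 / real N) = inverse ((4 / \<omega>) powr (2 / real N))"
          by (metis inverse_powr inverse_divide)
        moreover have "(1 / Q) powr \<gamma> = inverse (Q powr \<gamma>)"
          by (metis inverse_powr inverse_eq_divide)
        ultimately show ?thesis unfolding e by (simp only:)
      qed
      also have "(1 / Q) powr \<gamma> = 2 powr (- \<gamma>) * M1 powr (- (p * \<gamma>)) * Mp powr \<gamma>"
      proof -
        have "1 / Q = inverse 2 * M1 powr (- p) * Mp"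
          using M1 Mp by (simp add: Q_def powr_minus field_simps)
        then have "(1 / Q) powr \<gamma> = inverse 2 powr \<gamma> * (M1 powr (- p)) powr \<gamma> * Mp powr \<gamma>"
          by (simp only: powr_mult)
        also have "inverse 2 powr \<gamma> = 2 powr (- \<gamma>)"
          by (simp only: inverse_powr powr_minus)
        also have "(M1 powr (- p)) powr \<gamma> = M1 powr (- (p * \<gamma>))"
          by (simp add: powr_powr)
        finally show ?thesis .
      qed
      finally have Lsinv: "1 / Ls\<^sup>2 =
        (\<omega> / 4) powr (2 / real N) * (2 powr (- \<gamma>) * M1 powr (- (p * \<gamma>)) * Mp powr \<gamma>)" .
      have "2 * c * min A B \<le> 2 * d * A"
        using c c0 AB by (intro mult_mono) auto
      also have "\<dots> = (R ^ N * \<omega> / 16 * Mp) * (R\<^sup>2 / 4 * (1 / Ls\<^sup>2))"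
      proof -
        have "A = R ^ N * R\<^sup>2 * M1 powr (- (p * \<gamma>)) * (Mp * Mp powr \<gamma>)"
          using Mp by (simp add: A_def power_add powr_add power2_eq_square)
        then show ?thesis unfolding Lsinv d_def by simp
      qed
      also have "\<dots> \<le> (R ^ N * \<omega> / 16 * Mp) * (1 / (real n)\<^sup>2)"
      proof (intro mult_left_mono)
        have "R\<^sup>2 * (real n)\<^sup>2 \<le> 4 * Ls\<^sup>2" using n_le R by (simp add: field_simps)
        then show "R\<^sup>2 / 4 * (1 / Ls\<^sup>2) \<le> 1 / (real n)\<^sup>2" using n Ls by (simp add: field_simps)
      qed (use R \<omega> Mp in auto)
      finally show ?thesis by (simp add: X_def A_def B_def c_def)
    qed
  qed
  ultimately show ?thesis
    unfolding N_def by (meson ennreal_leI order_trans)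
qed

lemma energy_ge_ball_energy:
  fixes w :: "'a::euclidean_space \<Rightarrow> real"
  assumes [measurable]: "w \<in> borel_measurable borel" and p: "p \<ge> 2"
  shows "ennreal (1 / 2) * ball_energy R (\<lambda>x. phi (p / 2) (w x)) \<le> energy p (indicator (ball 0 R)) w"
proof -
  have "ennreal (1 / p) * ball_energy R (\<lambda>x. phi (p / 2) (w x)) =
      (\<integral>\<^sup>+x. (\<integral>\<^sup>+y. ennreal (1 / p) *
        ennreal (indicator (ball 0 R) (x - y) * (phi (p / 2) (w x) - phi (p / 2) (w y))\<^sup>2) \<partial>lborel) \<partial>lborel)"
    unfolding ball_energy_def by (simp add: nn_integral_cmult)
  also have "\<dots> \<le> (\<integral>\<^sup>+x. (\<integral>\<^sup>+y. ennreal (indicator (ball 0 R) (x - y) * (w x - w y) *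
        (phi (p - 1) (w x) - phi (p - 1) (w y))) \<partial>lborel) \<partial>lborel)"
  proof (intro nn_integral_mono)
    fix x y
    have "1 / p * (phi (p / 2) (w x) - phi (p / 2) (w y))\<^sup>2 \<le>
        (w x - w y) * (phi (p - 1) (w x) - phi (p - 1) (w y))"
      using phi_half_diff_squared_le[OF p, of "w x" "w y"] p by (simp add: field_simps)
    then show "ennreal (1 / p) *
        ennreal (indicator (ball 0 R) (x - y) * (phi (p / 2) (w x) - phi (p / 2) (w y))\<^sup>2)
        \<le> ennreal (indicator (ball 0 R) (x - y) * (w x - w y) *
        (phi (p - 1) (w x) - phi (p - 1) (w y)))"
      using p by (subst ennreal_mult'[symmetric]) (auto intro!: ennreal_leI simp: indicator_def)
  qed
  finally have "ennreal (p / 2) * (ennreal (1 / p) * ball_energy R (\<lambda>x. phi (p / 2) (w x)))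
      \<le> energy p (indicator (ball 0 R)) w"
    unfolding energy_def nn_integral_completion by (rule mult_left_mono) simp
  moreover have "ennreal (1 / 2) = ennreal (p / 2) * ennreal (1 / p)"
    using p by (subst ennreal_mult[symmetric]) auto
  ultimately show ?thesis by (simp only: mult.assoc)
qed

lemma energy_cong_AE:
  assumes "AE x in lborel. w x = w' x"
  shows "energy p J w = energy p J w'"
proof -
  have "(\<integral>\<^sup>+x. (\<integral>\<^sup>+y. ennreal (J (x - y) * (w x - w y) * (phi (p - 1) (w x) - phi (p - 1) (w y))) \<partial>lborel) \<partial>lborel)
    = (\<integral>\<^sup>+x. (\<integral>\<^sup>+y. ennreal (J (x - y) * (w' x - w' y) * (phi (p - 1) (w' x) - phi (p - 1) (w' y))) \<partial>lborel) \<partial>lborel)"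
  proof (rule nn_integral_cong_AE)
    show "AE x in lborel. (\<integral>\<^sup>+y. ennreal (J (x - y) * (w x - w y) * (phi (p - 1) (w x) - phi (p - 1) (w y))) \<partial>lborel)
      = (\<integral>\<^sup>+y. ennreal (J (x - y) * (w' x - w' y) * (phi (p - 1) (w' x) - phi (p - 1) (w' y))) \<partial>lborel)"
      using assms
    proof eventually_elim
      case (elim x)
      show ?case
        by (rule nn_integral_cong_AE) (use assms in eventually_elim, use elim in simp)
    qed
  qed
  then show ?thesis unfolding energy_def nn_integral_completion by simp
qed

lemma energy_kernel_mono:
  fixes w :: "'a::euclidean_space \<Rightarrow> real"
  assumes [measurable]: "w \<in> borel_measurable borel" and p: "p \<ge> 1" and r: "r \<ge> 0"
    and J: "\<And>z. r * indicator (ball 0 R) z \<le> J z"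
  shows "ennreal r * energy p (indicator (ball 0 R)) w \<le> energy p J w"
proof -
  let ?D = "\<lambda>x y. (w x - w y) * (phi (p - 1) (w x) - phi (p - 1) (w y))"
  have "ennreal r * (\<integral>\<^sup>+x. (\<integral>\<^sup>+y. ennreal (indicator (ball 0 R) (x - y) * (w x - w y) *
        (phi (p - 1) (w x) - phi (p - 1) (w y))) \<partial>lborel) \<partial>lborel)
     = (\<integral>\<^sup>+x. (\<integral>\<^sup>+y. ennreal r * ennreal (indicator (ball 0 R) (x - y) * (w x - w y) *
        (phi (p - 1) (w x) - phi (p - 1) (w y))) \<partial>lborel) \<partial>lborel)"
    by (simp add: nn_integral_cmult)
  also have "\<dots> \<le> (\<integral>\<^sup>+x. (\<integral>\<^sup>+y. ennreal (J (x - y) * (w x - w y) *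
        (phi (p - 1) (w x) - phi (p - 1) (w y))) \<partial>lborel) \<partial>lborel)"
  proof (intro nn_integral_mono)
    fix x y
    have "r * indicator (ball 0 R) (x - y) * ?D x y \<le> J (x - y) * ?D x y"
      using J phi_energy_nonneg[of "p - 1"] p by (intro mult_right_mono) auto
    then show "ennreal r * ennreal (indicator (ball 0 R) (x - y) * (w x - w y) *
        (phi (p - 1) (w x) - phi (p - 1) (w y))) \<le> ennreal (J (x - y) * (w x - w y) *
        (phi (p - 1) (w x) - phi (p - 1) (w y)))"
      using r by (subst ennreal_mult'[symmetric]) (auto intro!: ennreal_leI simp: mult.assoc)
  qed
  finally have "ennreal (p / 2) * (ennreal r * (\<integral>\<^sup>+x. (\<integral>\<^sup>+y. ennreal (indicator (ball 0 R) (x - y) * (w x - w y) *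
        (phi (p - 1) (w x) - phi (p - 1) (w y))) \<partial>lborel) \<partial>lborel)) \<le> energy p J w"
    unfolding energy_def nn_integral_completion by (intro mult_left_mono) auto
  then show ?thesis unfolding energy_def nn_integral_completion by (simp add: ac_simps)
qed

lemma energy_inequality_ball:
  fixes w :: "'a::euclidean_space \<Rightarrow> real" and p \<gamma> :: real
  defines "\<gamma> \<equiv> 2 / (real DIM('a) * (p - 1))"
  assumes w: "w \<in> borel_measurable borel" and p: "p \<ge> 2"
    and M1: "(\<integral>\<^sup>+x. ennreal \<bar>w x\<bar> \<partial>lborel) = ennreal M1" "M1 \<ge> 0"
    and Mp: "(\<integral>\<^sup>+x. ennreal (\<bar>w x\<bar> powr p) \<partial>lborel) = ennreal Mp" "Mp \<ge> 0"
    and R: "R > 0"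
  shows "ennreal (energy_const TYPE('a) p *
      min (R ^ (DIM('a) + 2) * M1 powr (- (p * \<gamma>)) * Mp powr (1 + \<gamma>)) (R ^ DIM('a) * Mp))
    \<le> energy p (indicator (ball 0 R)) w"
proof (cases "Mp = 0 \<or> M1 = 0")
  case True
  \<comment> \<open>Since \<open>0 powr a = 0\<close> for every \<open>a\<close>, the minimum is at most \<open>0\<close> even if only \<open>M1\<close> vanishes.\<close>
  then have "Mp = 0 \<or> M1 powr (- (p * \<gamma>)) = 0" by auto
  then have "min (R ^ (DIM('a) + 2) * M1 powr (- (p * \<gamma>)) * Mp powr (1 + \<gamma>)) (R ^ DIM('a) * Mp) \<le> 0"
    by auto
  then have "energy_const TYPE('a) p *
      min (R ^ (DIM('a) + 2) * M1 powr (- (p * \<gamma>)) * Mp powr (1 + \<gamma>)) (R ^ DIM('a) * Mp) \<le> 0"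
    using energy_const_pos[where 'a='a, of p] by (intro mult_nonneg_nonpos) auto
  then show ?thesis by (simp add: ennreal_neg)
next
  case False
  let ?m = "min (R ^ (DIM('a) + 2) * M1 powr (- (p * \<gamma>)) * Mp powr (1 + \<gamma>)) (R ^ DIM('a) * Mp)"
  have "ennreal (energy_const TYPE('a) p * ?m) =
      ennreal (1 / 2) * ennreal (2 * energy_const TYPE('a) p * ?m)"
    by (subst ennreal_mult'[symmetric]) auto
  also have "\<dots> \<le> ennreal (1 / 2) * ball_energy R (\<lambda>x. phi (p / 2) (w x))"
    using False M1 Mp R p w unfolding \<gamma>_def by (intro mult_left_mono ball_energy_ge) auto
  also have "\<dots> \<le> energy p (indicator (ball 0 R)) w"
    by (rule energy_ge_ball_energy[OF w p])
  finally show ?thesis .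
qed

section \<open>The dissipation of the nonlocal diffusion operator\<close>

lemma distr_lborel_reflection: "distr lborel borel (\<lambda>y. c - y) = (lborel :: 'a::euclidean_space measure)"
proof (rule measure_eqI)
  fix A assume "A \<in> sets (distr lborel borel (\<lambda>y. c - y))"
  then have [measurable]: "A \<in> sets borel" by simp
  have "emeasure (distr lborel borel (\<lambda>y. c - y)) A =
      (\<integral>\<^sup>+y. indicator A y \<partial>distr lborel borel (\<lambda>y. c - y))"
    by (simp add: nn_integral_indicator)
  also have "\<dots> = (\<integral>\<^sup>+y. indicator A (c - y) \<partial>lborel)"
    by (rule nn_integral_distr) measurable
  also have "\<dots> = (\<integral>\<^sup>+y. indicator A y \<partial>lborel)"
    by (rule nn_integral_lborel_reflection) measurable
  finally show "emeasure (distr lborel borel (\<lambda>y. c - y)) A = emeasure lborel A" by simp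
qed simp

lemma lborel_reflection:
  fixes f :: "'a::euclidean_space \<Rightarrow> real"
  assumes f: "integrable lborel f"
  shows integrable_lborel_reflection: "integrable lborel (\<lambda>y. f (c - y))"
    and integral_lborel_reflection: "(\<integral>y. f (c - y) \<partial>lborel) = (\<integral>y. f y \<partial>lborel)"
proof -
  have [measurable]: "f \<in> borel_measurable borel" using f by auto
  show "integrable lborel (\<lambda>y. f (c - y))"
    using f by (subst (asm) distr_lborel_reflection[symmetric, of c]) (simp add: integrable_distr_eq)
  show "(\<integral>y. f (c - y) \<partial>lborel) = (\<integral>y. f y \<partial>lborel)"
    by (subst (2) distr_lborel_reflection[symmetric, of c]) (simp add: integral_distr)
qed

lemma convolution_kernel_fst:
  fixes K h :: "'a::euclidean_space \<Rightarrow> real"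
  assumes K: "integrable lborel K" and h: "integrable lborel h"
  shows "integrable (lborel \<Otimes>\<^sub>M lborel) (\<lambda>(x, y). K (x - y) * h x)"
    and "integral\<^sup>L (lborel \<Otimes>\<^sub>M lborel) (\<lambda>(x, y). K (x - y) * h x) =
      (\<integral>z. K z \<partial>lborel) * (\<integral>x. h x \<partial>lborel)"
proof -
  have [measurable]: "K \<in> borel_measurable borel" "h \<in> borel_measurable borel" using K h by auto
  have eq: "(\<integral>y. norm (K (x - y) * h x) \<partial>lborel) = (\<integral>z. \<bar>K z\<bar> \<partial>lborel) * \<bar>h x\<bar>" for x
    using integral_lborel_reflection[of "\<lambda>z. \<bar>K z\<bar>" x] K by (simp add: abs_mult)
  show int: "integrable (lborel \<Otimes>\<^sub>M lborel) (\<lambda>(x, y). K (x - y) * h x)"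
  proof (rule lborel_pair.Fubini_integrable)
    show "integrable lborel (\<lambda>x. \<integral>y. norm (case (x, y) of (x, y) \<Rightarrow> K (x - y) * h x) \<partial>lborel)"
      unfolding prod.case eq using h by auto
    show "AE x in lborel. integrable lborel (\<lambda>y. case (x, y) of (x, y) \<Rightarrow> K (x - y) * h x)"
      using integrable_lborel_reflection[OF K] by auto
  qed measurable
  show "integral\<^sup>L (lborel \<Otimes>\<^sub>M lborel) (\<lambda>(x, y). K (x - y) * h x) =
      (\<integral>z. K z \<partial>lborel) * (\<integral>x. h x \<partial>lborel)"
    using lborel_pair.integral_fst'[OF int] integral_lborel_reflection[OF K] by simp
qed

lemma convolution_kernel_snd:
  fixes K h :: "'a::euclidean_space \<Rightarrow> real"
  assumes K: "integrable lborel K" and h: "integrable lborel h"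
  shows "integrable (lborel \<Otimes>\<^sub>M lborel) (\<lambda>(x, y). K (x - y) * h y)"
    and "integral\<^sup>L (lborel \<Otimes>\<^sub>M lborel) (\<lambda>(x, y). K (x - y) * h y) =
      (\<integral>z. K z \<partial>lborel) * (\<integral>x. h x \<partial>lborel)"
proof -
  have [measurable]: "K \<in> borel_measurable borel" "h \<in> borel_measurable borel" using K h by auto
  have K': "integrable lborel (\<lambda>z. K (- z))" "(\<integral>z. K (- z) \<partial>lborel) = (\<integral>z. K z \<partial>lborel)"
    using lborel_reflection[OF K, of 0] by auto
  note F = convolution_kernel_fst[OF K'(1) h]
  show "integrable (lborel \<Otimes>\<^sub>M lborel) (\<lambda>(x, y). K (x - y) * h y)"
    using lborel_pair.integrable_product_swap[OF F(1)] by simp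
  have "integral\<^sup>L (lborel \<Otimes>\<^sub>M lborel) (\<lambda>(x, y). K (x - y) * h y) =
      integral\<^sup>L (lborel \<Otimes>\<^sub>M lborel) (\<lambda>(x, y). K (- (x - y)) * h x)"
    using lborel_pair.integral_product_swap[of "\<lambda>(x, y). K (- (x - y)) * h x"] by simp
  then show "integral\<^sup>L (lborel \<Otimes>\<^sub>M lborel) (\<lambda>(x, y). K (x - y) * h y) =
      (\<integral>z. K z \<partial>lborel) * (\<integral>x. h x \<partial>lborel)"
    using F(2) K'(2) by simp
qed

text \<open>The excess of \<open>\<bar>b\<bar>\<^sup>q\<close> over the tangent at \<open>a\<close> of the convex function \<open>s \<mapsto> \<bar>s\<bar>\<^sup>q\<close>.\<close>

definition bregman :: "real \<Rightarrow> real \<Rightarrow> real \<Rightarrow> real" where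
  "bregman q b a = \<bar>b\<bar> powr q - \<bar>a\<bar> powr q - q * phi (q - 1) a * (b - a)"

lemma bregman_nonneg: "q \<ge> 1 \<Longrightarrow> 0 \<le> bregman q b a"
  using powr_above_tangent[of q a b] by (simp add: bregman_def)

lemma bregman_symmetrized:
  "bregman q b a + bregman q a b = q * ((a - b) * (phi (q - 1) a - phi (q - 1) b))"
  by (simp add: bregman_def algebra_simps)

lemma measurable_bregman[measurable]:
  assumes [measurable]: "f \<in> borel_measurable M" "g \<in> borel_measurable M"
  shows "(\<lambda>x. bregman q (f x) (g x)) \<in> borel_measurable M"
  unfolding bregman_def by measurable

text \<open>The kernel need not be symmetric: the contributions of \<open>\<bar>u(y)\<bar>\<^sup>q\<close> and \<open>\<bar>u(x)\<bar>\<^sup>q\<close> cancel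
  because both have the integral of \<open>K\<close> as a factor.\<close>

lemma dissipation_eq_bregman:
  fixes K u :: "'a::euclidean_space \<Rightarrow> real"
  assumes q: "q \<ge> 1" and K: "integrable lborel K" "\<And>z. K z \<ge> 0"
    and u[measurable]: "u \<in> borel_measurable borel" and uq: "integrable lborel (\<lambda>x. \<bar>u x\<bar> powr q)"
  defines "I \<equiv> - q * (\<integral>x. phi (q - 1) (u x) * (\<integral>y. K (x - y) * (u y - u x) \<partial>lborel) \<partial>lborel)"
  shows "I \<ge> 0"
    and "ennreal I = (\<integral>\<^sup>+x. (\<integral>\<^sup>+y. ennreal (K (x - y) * bregman q (u y) (u x)) \<partial>lborel) \<partial>lborel)"
proof -
  have [measurable]: "K \<in> borel_measurable borel" using K by auto
  let ?P = "lborel \<Otimes>\<^sub>M lborel :: ('a \<times> 'a) measure"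
  let ?G = "\<lambda>(x, y). K (x - y) * (phi (q - 1) (u x) * (u y - u x))"
  let ?B = "\<lambda>(x, y). K (x - y) * bregman q (u y) (u x)"
  let ?U1 = "\<lambda>(x, y). K (x - y) * \<bar>u x\<bar> powr q" and ?U2 = "\<lambda>(x, y). K (x - y) * \<bar>u y\<bar> powr q"
  note U1 = convolution_kernel_fst[OF K(1) uq] and U2 = convolution_kernel_snd[OF K(1) uq]
  have G: "integrable ?P ?G"
  proof (rule Bochner_Integration.integrable_bound)
    show "integrable ?P (\<lambda>z. 2 * ?U1 z + ?U2 z)" using U1 U2 by auto
    show "AE z in ?P. norm (?G z) \<le> norm (2 * ?U1 z + ?U2 z)"
    proof (rule AE_I2, safe)
      fix x y
      have "\<bar>phi (q - 1) (u x) * (u y - u x)\<bar> \<le> \<bar>phi (q - 1) (u x) * u y\<bar> + \<bar>phi (q - 1) (u x) * u x\<bar>"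
        by (simp add: algebra_simps)
      also have "\<dots> \<le> (\<bar>u x\<bar> powr q + \<bar>u y\<bar> powr q) + \<bar>u x\<bar> powr q"
        using phi_mult_le_Young[OF q, of 1 "u x" "u y"] by (simp add: phi_mult_self)
      finally have "K (x - y) * \<bar>phi (q - 1) (u x) * (u y - u x)\<bar> \<le>
          K (x - y) * (2 * \<bar>u x\<bar> powr q + \<bar>u y\<bar> powr q)"
        using K(2) by (intro mult_left_mono) auto
      also have "\<dots> \<le> norm (2 * (K (x - y) * \<bar>u x\<bar> powr q) + K (x - y) * \<bar>u y\<bar> powr q)"
        by (simp add: distrib_left)
      finally show "norm (K (x - y) * (phi (q - 1) (u x) * (u y - u x))) \<le>
          norm (2 * (K (x - y) * \<bar>u x\<bar> powr q) + K (x - y) * \<bar>u y\<bar> powr q)"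
        unfolding real_norm_def abs_mult[of "K _"] abs_of_nonneg[OF K(2)] .
    qed
  qed measurable
  have "I = - q * integral\<^sup>L ?P ?G"
    unfolding I_def lborel_pair.integral_fst'[OF G, symmetric]
    by (simp add: mult.left_commute[of "K _"])
  have Beq: "?B = (\<lambda>z. ?U2 z - ?U1 z - q * ?G z)"
    by (auto simp: bregman_def algebra_simps)
  have diff: "integrable ?P (\<lambda>z. b z - a z - q * g z)"
    "integral\<^sup>L ?P (\<lambda>z. b z - a z - q * g z) = integral\<^sup>L ?P b - integral\<^sup>L ?P a - q * integral\<^sup>L ?P g"
    if "integrable ?P a" "integrable ?P b" "integrable ?P g" for a b g using that by auto
  have B: "integrable ?P ?B" unfolding Beq by (rule diff(1)[OF U1(1) U2(1) G])
  have "integral\<^sup>L ?P ?B = - q * integral\<^sup>L ?P ?G"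
    unfolding Beq diff(2)[OF U1(1) U2(1) G] U1(2) U2(2) by simp
  with \<open>I = - q * integral\<^sup>L ?P ?G\<close> have I: "I = integral\<^sup>L ?P ?B" by simp
  have B0: "?B z \<ge> 0" for z using K(2) bregman_nonneg[OF q] by (auto split: prod.splits)
  show "I \<ge> 0" unfolding I using B0 by (intro integral_nonneg_AE) auto
  have "ennreal I = (\<integral>\<^sup>+z. ennreal (?B z) \<partial>?P)"
    unfolding I using B B0 by (intro nn_integral_eq_integral[symmetric]) auto
  also have "\<dots> = (\<integral>\<^sup>+x. (\<integral>\<^sup>+y. ennreal (?B (x, y)) \<partial>lborel) \<partial>lborel)"
    by (rule lborel.nn_integral_fst[symmetric]) measurable
  finally show "ennreal I = (\<integral>\<^sup>+x. (\<integral>\<^sup>+y. ennreal (K (x - y) * bregman q (u y) (u x)) \<partial>lborel) \<partial>lborel)"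
    by simp
qed

text \<open>For the symmetric kernel \<open>indicator (ball 0 R)\<close> the dissipation is the energy.\<close>

lemma bregman_ball_eq_energy:
  fixes u :: "'a::euclidean_space \<Rightarrow> real"
  assumes q: "q \<ge> 1" and u[measurable]: "u \<in> borel_measurable borel"
  shows "(\<integral>\<^sup>+x. (\<integral>\<^sup>+y. ennreal (indicator (ball 0 R) (x - y) * bregman q (u y) (u x)) \<partial>lborel) \<partial>lborel)
     = energy q (indicator (ball 0 R)) u" (is "?S = _")
proof -
  let ?i = "\<lambda>x y. indicator (ball (0::'a) R) (x - y) :: real"
  have sym: "?i x y = ?i y x" for x y by (simp add: indicator_def norm_minus_commute)
  have "?S = (\<integral>\<^sup>+y. (\<integral>\<^sup>+x. ennreal (?i x y * bregman q (u y) (u x)) \<partial>lborel) \<partial>lborel)"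
    by (rule lborel_pair.Fubini'[symmetric]) measurable
  then have S': "?S = (\<integral>\<^sup>+x. (\<integral>\<^sup>+y. ennreal (?i x y * bregman q (u x) (u y)) \<partial>lborel) \<partial>lborel)"
    by (subst (asm) sym) simp
  have "2 * ?S = ?S + (\<integral>\<^sup>+x. (\<integral>\<^sup>+y. ennreal (?i x y * bregman q (u x) (u y)) \<partial>lborel) \<partial>lborel)"
    unfolding S'[symmetric] by (rule mult_2)
  also have "\<dots> = (\<integral>\<^sup>+x. (\<integral>\<^sup>+y. ennreal (?i x y * bregman q (u y) (u x)) +
      ennreal (?i x y * bregman q (u x) (u y)) \<partial>lborel) \<partial>lborel)"
    by (simp add: nn_integral_add)
  also have "\<dots> = (\<integral>\<^sup>+x. (\<integral>\<^sup>+y. ennreal q *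
      ennreal (?i x y * (u x - u y) * (phi (q - 1) (u x) - phi (q - 1) (u y))) \<partial>lborel) \<partial>lborel)"
  proof (intro nn_integral_cong)
    fix x y
    have "ennreal (?i x y * bregman q (u y) (u x)) + ennreal (?i x y * bregman q (u x) (u y)) =
        ennreal (?i x y * bregman q (u y) (u x) + ?i x y * bregman q (u x) (u y))"
      using bregman_nonneg[OF q] by (intro ennreal_plus[symmetric]) auto
    also have "?i x y * bregman q (u y) (u x) + ?i x y * bregman q (u x) (u y) =
        q * (?i x y * (u x - u y) * (phi (q - 1) (u x) - phi (q - 1) (u y)))"
      unfolding distrib_left[symmetric] bregman_symmetrized by simp
    finally show "ennreal (?i x y * bregman q (u y) (u x)) + ennreal (?i x y * bregman q (u x) (u y)) =
        ennreal q * ennreal (?i x y * (u x - u y) * (phi (q - 1) (u x) - phi (q - 1) (u y)))"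
      using q by (simp only: ennreal_mult')
  qed
  also have "\<dots> = ennreal q * (\<integral>\<^sup>+x. (\<integral>\<^sup>+y.
      ennreal (?i x y * (u x - u y) * (phi (q - 1) (u x) - phi (q - 1) (u y))) \<partial>lborel) \<partial>lborel)"
    by (simp add: nn_integral_cmult)
  also have "ennreal q = 2 * ennreal (q / 2)"
    using q ennreal_mult[of 2 "q / 2"] by simp
  also have "2 * ennreal (q / 2) * (\<integral>\<^sup>+x. (\<integral>\<^sup>+y.
      ennreal (?i x y * (u x - u y) * (phi (q - 1) (u x) - phi (q - 1) (u y))) \<partial>lborel) \<partial>lborel)
      = 2 * energy q (indicator (ball 0 R)) u"
    unfolding energy_def nn_integral_completion by (rule mult.assoc)
  finally show ?thesis by (subst (asm) ennreal_mult_cancel_left) auto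
qed

text \<open>The dissipation is monotone in the kernel because the Bregman distance is nonnegative. This
  reduces a kernel that need not be symmetric to the indicator of a ball.\<close>

lemma dissipation_ge_energy:
  fixes K u :: "'a::euclidean_space \<Rightarrow> real"
  assumes q: "q \<ge> 1" and K: "integrable lborel K" and r: "r \<ge> 0"
    and Kr: "\<And>z. r * indicator (ball 0 R) z \<le> K z"
    and u[measurable]: "u \<in> borel_measurable borel" and uq: "integrable lborel (\<lambda>x. \<bar>u x\<bar> powr q)"
  shows "ennreal r * energy q (indicator (ball 0 R)) u \<le>
    ennreal (- q * (\<integral>x. phi (q - 1) (u x) * (\<integral>y. K (x - y) * (u y - u x) \<partial>lborel) \<partial>lborel))"
proof -
  have K0: "K z \<ge> 0" for z
    using Kr[of z] r by (intro order_trans[OF _ Kr]) (simp add: indicator_def)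
  let ?i = "\<lambda>x y. indicator (ball (0::'a) R) (x - y) :: real"
  have "ennreal r * energy q (indicator (ball 0 R)) u =
      (\<integral>\<^sup>+x. (\<integral>\<^sup>+y. ennreal r * ennreal (?i x y * bregman q (u y) (u x)) \<partial>lborel) \<partial>lborel)"
    unfolding bregman_ball_eq_energy[OF q u, symmetric] by (simp add: nn_integral_cmult)
  also have "\<dots> \<le> (\<integral>\<^sup>+x. (\<integral>\<^sup>+y. ennreal (K (x - y) * bregman q (u y) (u x)) \<partial>lborel) \<partial>lborel)"
  proof (intro nn_integral_mono)
    fix x y
    have "r * ?i x y * bregman q (u y) (u x) \<le> K (x - y) * bregman q (u y) (u x)"
      using Kr bregman_nonneg[OF q] by (intro mult_right_mono) auto
    then show "ennreal r * ennreal (?i x y * bregman q (u y) (u x)) \<le>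
        ennreal (K (x - y) * bregman q (u y) (u x))"
      using r by (subst ennreal_mult'[symmetric]) (auto intro!: ennreal_leI simp: mult.assoc)
  qed
  also have "\<dots> = ennreal (- q * (\<integral>x. phi (q - 1) (u x) * (\<integral>y. K (x - y) * (u y - u x) \<partial>lborel) \<partial>lborel))"
    by (rule dissipation_eq_bregman(2)[OF q K K0 u uq, symmetric])
  finally show ?thesis .
qed

lemma borel_measurable_lebesgue_AE:
  fixes f g :: "'a::euclidean_space \<Rightarrow> real"
  assumes g: "g \<in> borel_measurable lebesgue" and ae: "AE x in lebesgue. f x = g x"
  shows "f \<in> borel_measurable lebesgue"
proof (rule measurableI)
  fix A :: "real set" assume "A \<in> sets borel"
  then have "g -` A \<inter> space lebesgue \<in> sets lebesgue" using g by (rule measurable_sets[rotated])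
  moreover have "AE x in lebesgue. x \<in> g -` A \<inter> space lebesgue \<longleftrightarrow> x \<in> f -` A \<inter> space lebesgue"
    using ae by eventually_elim auto
  ultimately show "f -` A \<inter> space lebesgue \<in> sets lebesgue"
    by (intro completion.in_sets_AE[OF _ _ Int_lower2])
qed simp

lemma integral_lebesgue_eq_lborel:
  fixes f g :: "'a::euclidean_space \<Rightarrow> real"
  assumes g: "g \<in> borel_measurable borel" and ae: "AE x in lborel. f x = g x"
  shows "(\<integral>x. f x \<partial>lebesgue) = (\<integral>x. g x \<partial>lborel)"
    and "integrable lebesgue f \<longleftrightarrow> integrable lborel g"
proof -
  have ae': "AE x in lebesgue. f x = g x" using ae by (rule AE_completion)
  have g': "g \<in> borel_measurable lebesgue" using g by (auto intro: measurable_completion)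
  have f: "f \<in> borel_measurable lebesgue" by (rule borel_measurable_lebesgue_AE[OF g' ae'])
  have "(\<integral>x. f x \<partial>lebesgue) = (\<integral>x. g x \<partial>lebesgue)"
    by (rule integral_cong_AE[OF f g' ae'])
  then show "(\<integral>x. f x \<partial>lebesgue) = (\<integral>x. g x \<partial>lborel)"
    using g by (simp add: integral_completion)
  have "integrable lebesgue f \<longleftrightarrow> integrable lebesgue g"
    by (rule integrable_cong_AE[OF f g' ae'])
  then show "integrable lebesgue f \<longleftrightarrow> integrable lborel g"
    using g by (simp add: integrable_completion)
qed

lemma Lp_space_borel_representative:
  fixes w :: "'a::euclidean_space \<Rightarrow> real"
  assumes w: "w \<in> borel_measurable lebesgue"
  obtains w' where "w' \<in> borel_measurable borel" "AE x in lborel. w x = w' x"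
    "\<And>q. (\<integral>x. \<bar>w x\<bar> powr q \<partial>lebesgue) = (\<integral>x. \<bar>w' x\<bar> powr q \<partial>lborel)"
    "\<And>q. w \<in> Lp_space q \<longleftrightarrow> integrable lborel (\<lambda>x. \<bar>w' x\<bar> powr q)"
proof -
  obtain w' where w'[measurable]: "w' \<in> borel_measurable borel" and ae: "AE x in lborel. w x = w' x"
    using completion_ex_borel_measurable_real[OF w] by auto
  have "AE x in lborel. \<bar>w x\<bar> powr q = \<bar>w' x\<bar> powr q" for q using ae by eventually_elim simp
  note eq = integral_lebesgue_eq_lborel[OF _ this]
  show ?thesis
    by (rule that[OF w' ae]) (use w in \<open>auto simp: Lp_space_def intro!: eq\<close>)
qed

text \<open>The inequality in the form that applies to a solution, where everything is only Lebesgue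
  measurable and \<open>v\<close> is the image of \<open>u\<close> under the diffusion operator.\<close>

lemma dissipation_lebesgue:
  fixes J u v :: "'a::euclidean_space \<Rightarrow> real"
  assumes q: "q \<ge> 1" and J: "J \<in> Lp_space 1" and r: "r \<ge> 0"
    and Jr: "\<And>z. r * indicator (ball 0 R) z \<le> J z"
    and u: "u \<in> Lp_space q"
    and v: "AE x in lebesgue. v x = (\<integral>y. J (x - y) * (u y - u x) \<partial>lebesgue)"
  defines "I \<equiv> - q * (\<integral>x. phi (q - 1) (u x) * v x \<partial>lebesgue)"
  shows "I \<ge> 0" and "ennreal r * energy q (indicator (ball 0 R)) u \<le> ennreal I"
proof -
  obtain J0 where J0[measurable]: "J0 \<in> borel_measurable borel" and J0ae: "AE z in lborel. J z = J0 z"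
    using completion_ex_borel_measurable_real[of J lborel] J by (auto simp: Lp_space_def)
  \<comment> \<open>The maximum keeps the lower bound valid everywhere, not only almost everywhere.\<close>
  define K where "K z = max (r * indicator (ball 0 R) z) (J0 z)" for z
  have K_meas[measurable]: "K \<in> borel_measurable borel" unfolding K_def by measurable
  have Kae: "AE z in lborel. J z = K z"
    using J0ae
  proof eventually_elim
    case (elim z)
    then show ?case using Jr[of z] by (simp add: K_def)
  qed
  have Kr: "r * indicator (ball 0 R) z \<le> K z" for z by (simp add: K_def)
  have K0: "K z \<ge> 0" for z
    using r by (intro order_trans[OF _ Kr]) (simp add: indicator_def)
  have "AE z in lborel. \<bar>J z\<bar> powr 1 = K z" using Kae by eventually_elim (simp add: K0)
  then have K: "integrable lborel K"
    using integral_lebesgue_eq_lborel(2)[OF K_meas, of "\<lambda>z. \<bar>J z\<bar> powr 1"] J by (simp add: Lp_space_def)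
  have "u \<in> borel_measurable lebesgue" using u by (simp add: Lp_space_def)
  then obtain u' where u'[measurable]: "u' \<in> borel_measurable borel" and uae: "AE x in lborel. u x = u' x"
    and "\<And>q. (\<integral>x. \<bar>u x\<bar> powr q \<partial>lebesgue) = (\<integral>x. \<bar>u' x\<bar> powr q \<partial>lborel)"
    and u_iff: "\<And>q. u \<in> Lp_space q \<longleftrightarrow> integrable lborel (\<lambda>x. \<bar>u' x\<bar> powr q)"
    by (rule Lp_space_borel_representative) blast
  have uq: "integrable lborel (\<lambda>x. \<bar>u' x\<bar> powr q)" using u u_iff by simp
  define v' where "v' x = (\<integral>y. K (x - y) * (u' y - u' x) \<partial>lborel)" for x
  have [measurable]: "v' \<in> borel_measurable borel" unfolding v'_def by measurable
  have "AE x in lborel. v x = v' x"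
    using v[unfolded AE_completion_iff] uae
  proof eventually_elim
    case (elim x)
    have "AE y in lborel. J (x - y) * (u y - u x) = K (x - y) * (u' y - u' x)"
      using AE_lborel_reflection[OF Kae, of x] uae by eventually_elim (simp add: elim)
    then have "(\<integral>y. J (x - y) * (u y - u x) \<partial>lebesgue) = v' x"
      unfolding v'_def by (intro integral_lebesgue_eq_lborel(1)) auto
    then show ?case using elim by simp
  qed
  then have "AE x in lborel. phi (q - 1) (u x) * v x = phi (q - 1) (u' x) * v' x"
    using uae by eventually_elim simp
  then have I: "I = - q * (\<integral>x. phi (q - 1) (u' x) * v' x \<partial>lborel)"
    unfolding I_def by (subst integral_lebesgue_eq_lborel(1)) auto
  show "I \<ge> 0" unfolding I v'_def by (rule dissipation_eq_bregman(1)[OF q K K0 u' uq])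
  show "ennreal r * energy q (indicator (ball 0 R)) u \<le> ennreal I"
    unfolding I v'_def energy_cong_AE[OF uae] by (rule dissipation_ge_energy[OF q K r Kr u' uq])
qed

section \<open>Differential inequalities for left derivatives\<close>

text \<open>The upper left Dini derivative of \<open>h\<close> at \<open>t\<close> is at most \<open>c\<close>.\<close>

definition left_Dini_le :: "(real \<Rightarrow> real) \<Rightarrow> real \<Rightarrow> real \<Rightarrow> bool" where
  "left_Dini_le h c t \<longleftrightarrow> (\<forall>\<epsilon>>0. \<forall>\<^sub>F s in at_left t. h t - h s \<le> (c + \<epsilon>) * (t - s))"

lemma left_Dini_le_weaken:
  assumes "left_Dini_le h c t" "c \<le> d"
  shows "left_Dini_le h d t"
  unfolding left_Dini_le_def
proof (intro allI impI)
  fix \<epsilon> :: real assume "\<epsilon> > 0"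
  then have "\<forall>\<^sub>F s in at_left t. h t - h s \<le> (c + \<epsilon>) * (t - s)"
    using assms(1) by (auto simp: left_Dini_le_def)
  moreover have "\<forall>\<^sub>F s in at_left t. s < t" by (simp add: eventually_at_filter)
  ultimately show "\<forall>\<^sub>F s in at_left t. h t - h s \<le> (d + \<epsilon>) * (t - s)"
  proof eventually_elim
    case (elim s)
    have "(c + \<epsilon>) * (t - s) \<le> (d + \<epsilon>) * (t - s)"
      using elim assms(2) by (intro mult_right_mono) auto
    then show ?case using elim by linarith
  qed
qed

lemma left_Dini_le_add_linear:
  assumes "left_Dini_le h c t"
  shows "left_Dini_le (\<lambda>s. h s + k * s) (c + k) t"
  unfolding left_Dini_le_def
proof (intro allI impI)
  fix \<epsilon> :: real assume "\<epsilon> > 0"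
  then have "\<forall>\<^sub>F s in at_left t. h t - h s \<le> (c + \<epsilon>) * (t - s)"
    using assms by (auto simp: left_Dini_le_def)
  then show "\<forall>\<^sub>F s in at_left t. h t + k * t - (h s + k * s) \<le> (c + k + \<epsilon>) * (t - s)"
    by eventually_elim (simp add: algebra_simps)
qed

lemma left_Dini_le_compose:
  assumes F: "left_Dini_le F c t" "(F \<longlongrightarrow> F t) (at_left t)"
    and \<psi>: "(\<psi> has_real_derivative d) (at (F t))" and d: "d > 0"
  shows "left_Dini_le (\<lambda>s. \<psi> (F s)) (d * c) t"
  unfolding left_Dini_le_def
proof (intro allI impI)
  fix \<epsilon> :: real assume \<epsilon>: "\<epsilon> > 0"
  obtain g where g: "\<And>z. \<psi> z - \<psi> (F t) = g z * (z - F t)" "isCont g (F t)" "g (F t) = d"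
    using \<psi> unfolding CARAT_DERIV by blast
  define \<eta> where "\<eta> = \<epsilon> / (2 * d)"
  have \<eta>: "\<eta> > 0" using \<epsilon> d by (simp add: \<eta>_def)
  have lim: "((\<lambda>s. g (F s)) \<longlongrightarrow> d) (at_left t)"
    using isCont_tendsto_compose[OF g(2) F(2)] g(3) by simp
  have "((\<lambda>s. g (F s) * (c + \<eta>)) \<longlongrightarrow> d * (c + \<eta>)) (at_left t)"
    by (intro tendsto_intros lim)
  moreover have "d * (c + \<eta>) < d * c + \<epsilon>"
    using d \<epsilon> by (simp add: \<eta>_def field_simps)
  ultimately have "\<forall>\<^sub>F s in at_left t. g (F s) * (c + \<eta>) < d * c + \<epsilon>"
    by (rule order_tendstoD(2))
  moreover have "\<forall>\<^sub>F s in at_left t. g (F s) > 0"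
    using lim d by (rule order_tendstoD(1))
  moreover have "\<forall>\<^sub>F s in at_left t. F t - F s \<le> (c + \<eta>) * (t - s)"
    using F(1) \<eta> by (auto simp: left_Dini_le_def)
  moreover have "\<forall>\<^sub>F s in at_left t. s < t" by (simp add: eventually_at_filter)
  ultimately show "\<forall>\<^sub>F s in at_left t. \<psi> (F t) - \<psi> (F s) \<le> (d * c + \<epsilon>) * (t - s)"
  proof eventually_elim
    case (elim s)
    have "\<psi> (F t) - \<psi> (F s) = g (F s) * (F t - F s)"
      using g(1)[of "F s"] by (simp add: algebra_simps)
    also have "\<dots> \<le> g (F s) * ((c + \<eta>) * (t - s))"
      using elim by (intro mult_left_mono) auto
    also have "\<dots> = g (F s) * (c + \<eta>) * (t - s)" by simp
    also have "\<dots> \<le> (d * c + \<epsilon>) * (t - s)"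
      using elim by (intro mult_right_mono) auto
    finally show ?case .
  qed
qed

text \<open>Continuity induction towards the left, starting from \<open>b\<close>.\<close>

lemma left_Dini_le_0_imp_decreasing:
  fixes h :: "real \<Rightarrow> real"
  assumes ab: "a \<le> b" and cont: "continuous_on {a..b} h"
    and Dini: "\<And>t. a < t \<Longrightarrow> t \<le> b \<Longrightarrow> left_Dini_le h 0 t"
  shows "h b \<le> h a"
proof (rule field_le_epsilon)
  fix e :: real assume e: "e > 0"
  define \<epsilon> where "\<epsilon> = e / (b - a + 1)"
  have \<epsilon>: "\<epsilon> > 0" using e ab by (simp add: \<epsilon>_def)
  define S where "S = {s \<in> {a..b}. h b - h s \<le> \<epsilon> * (b - s)}"
  have "closed S"
    unfolding S_def by (intro continuous_on_closed_Collect_le continuous_intros cont)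
  then have S: "closed S" "b \<in> S" "bdd_below S"
    using ab by (auto simp: S_def)
  define m where "m = Inf S"
  have m: "m \<in> S" unfolding m_def using S by (intro closed_contains_Inf) auto
  have "m = a"
  proof (rule ccontr)
    assume "m \<noteq> a"
    then have "a < m" "m \<le> b" using m by (auto simp: S_def)
    then have "\<forall>\<^sub>F s in at_left m. h m - h s \<le> (0 + \<epsilon>) * (m - s)"
      using Dini[of m] \<epsilon> by (auto simp: left_Dini_le_def)
    moreover have "\<forall>\<^sub>F s in at_left m. s \<in> {a<..<m}"
      by (rule eventually_at_left_real[OF \<open>a < m\<close>])
    ultimately have "\<forall>\<^sub>F s in at_left m. s \<in> S \<and> s < m"
    proof eventually_elim
      case (elim s)
      then show ?case using m by (auto simp: S_def algebra_simps)
    qed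
    then obtain s where "s \<in> S" "s < m"
      using eventually_happens'[of "at_left m"] by (auto simp: trivial_limit_at_left_real)
    moreover have "m \<le> s" unfolding m_def using S \<open>s \<in> S\<close> by (intro cInf_lower) auto
    ultimately show False by simp
  qed
  then have "h b - h a \<le> \<epsilon> * (b - a)" using m by (simp add: S_def)
  also have "\<dots> \<le> \<epsilon> * (b - a + 1)" using \<epsilon> by (intro mult_left_mono) auto
  also have "\<dots> = e" using ab by (simp add: \<epsilon>_def)
  finally show "h b \<le> h a + e" by simp
qed

text \<open>The comparison principle for \<open>F' \<le> - \<kappa> min (F, A F\<^bsup>1+\<gamma>\<^esup>)\<close>: exponential decay until
  \<open>F\<close> reaches the level \<open>A\<^bsup>-1/\<gamma>\<^esup>\<close>, which happens by the time \<open>t0\<close>, and algebraic decay afterwards.\<close>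

lemma decay_of_left_Dini:
  fixes F :: "real \<Rightarrow> real" and \<kappa> A \<gamma> :: real
  assumes cont: "continuous_on {0..} F" and F0: "\<And>t. t \<ge> 0 \<Longrightarrow> F t \<ge> 0"
    and pos: "\<kappa> > 0" "A > 0" "\<gamma> > 0"
    and Dini: "\<And>t. t > 0 \<Longrightarrow> left_Dini_le F (- (\<kappa> * min (F t) (A * F t powr (1 + \<gamma>)))) t"
  defines "t0 \<equiv> max 0 (1 / \<kappa> * ln (A powr (1 / \<gamma>) * F 0))"
  shows "\<And>t. t \<ge> 0 \<Longrightarrow> F t \<le> F 0"
    and "\<And>t. t \<ge> t0 \<Longrightarrow> F t \<le> (F 0 powr (- \<gamma>) + \<gamma> * \<kappa> * A * (t - t0)) powr (- (1 / \<gamma>))"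
proof -
  have cont': "continuous_on {a..b} F" if "0 \<le> a" for a b
    using that by (intro continuous_on_subset[OF cont]) auto
  have lim: "(F \<longlongrightarrow> F t) (at_left t)" if "t > 0" for t
  proof -
    have "continuous (at t) F"
      using continuous_on_interior[OF cont, of t] that by simp
    then show ?thesis by (simp add: continuous_at filterlim_at_split)
  qed
  have dec: "F b \<le> F a" if "0 \<le> a" "a \<le> b" for a b
  proof (rule left_Dini_le_0_imp_decreasing[OF that(2) cont'[OF that(1)]])
    fix t assume "a < t" "t \<le> b"
    then have "t > 0" using that by simp
    then show "left_Dini_le F 0 t"
      using pos F0[of t] by (intro left_Dini_le_weaken[OF Dini]) auto
  qed
  show "F t \<le> F 0" if "t \<ge> 0" for t using dec[of 0 t] that by simp
  have t0: "t0 \<ge> 0" by (simp add: t0_def)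
  define Y where "Y = A powr (- (1 / \<gamma>))"
  have Y: "Y > 0" using pos by (simp add: Y_def)
  have "Y powr \<gamma> = inverse A"
    unfolding Y_def powr_powr using pos by (simp add: powr_minus)
  then have Y\<gamma>: "A * Y powr \<gamma> = 1" using pos by simp
  have F_split: "A * y powr (1 + \<gamma>) = y * (A * y powr \<gamma>)" if "y \<ge> 0" for y
    using that powr_mult_base[of y \<gamma>] by simp
  have F_t0: "F t0 \<le> Y"
  proof (rule ccontr)
    assume "\<not> F t0 \<le> Y"
    then have big: "F s > Y" if "0 \<le> s" "s \<le> t0" for s using dec[of s t0] that by linarith
    then have F0_pos: "F 0 > 0" and Ft0_pos: "F t0 > 0" using t0 Y by force+
    have lnY: "ln (A powr (1 / \<gamma>) * F 0) = ln (F 0) - ln Y"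
      using pos F0_pos by (simp add: Y_def ln_mult ln_powr)
    have "ln (F t0) + \<kappa> * t0 \<le> ln (F 0) + \<kappa> * 0"
    proof (rule left_Dini_le_0_imp_decreasing[OF t0])
      show "continuous_on {0..t0} (\<lambda>s. ln (F s) + \<kappa> * s)"
        using big Y by (intro continuous_intros cont') (auto, force)
      fix t assume t: "0 < t" "t \<le> t0"
      have Ft: "F t > Y" using big t by simp
      have "A * Y powr \<gamma> \<le> A * F t powr \<gamma>"
        using Ft Y pos by (intro mult_left_mono powr_mono2) auto
      then have "F t * 1 \<le> F t * (A * F t powr \<gamma>)"
        unfolding Y\<gamma> using Ft Y by (intro mult_left_mono) auto
      then have "F t \<le> A * F t powr (1 + \<gamma>)"
        using Ft Y by (subst F_split) auto
      then have min: "min (F t) (A * F t powr (1 + \<gamma>)) = F t" by simp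
      have "((ln :: real \<Rightarrow> real) has_real_derivative 1 / F t) (at (F t))"
        using Ft Y by (auto intro!: derivative_eq_intros)
      then have "left_Dini_le (\<lambda>s. ln (F s)) (1 / F t * - (\<kappa> * F t)) t"
        using Dini[OF t(1)] Ft Y unfolding min by (intro left_Dini_le_compose lim t) auto
      then have "left_Dini_le (\<lambda>s. ln (F s) + \<kappa> * s) (1 / F t * - (\<kappa> * F t) + \<kappa>) t"
        by (rule left_Dini_le_add_linear)
      then show "left_Dini_le (\<lambda>s. ln (F s) + \<kappa> * s) 0 t" using Ft Y by simp
    qed
    moreover have "\<kappa> * t0 \<ge> ln (F 0) - ln Y"
    proof -
      have "1 / \<kappa> * (ln (F 0) - ln Y) \<le> t0" unfolding t0_def lnY by simp
      then show ?thesis using pos by (simp add: field_simps)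
    qed
    ultimately have "ln (F t0) \<le> ln Y" by simp
    then show False using \<open>\<not> F t0 \<le> Y\<close> Ft0_pos Y by simp
  qed
  show "F t \<le> (F 0 powr (- \<gamma>) + \<gamma> * \<kappa> * A * (t - t0)) powr (- (1 / \<gamma>))" if t: "t \<ge> t0" for t
  proof (cases "F t = 0")
    case True
    then show ?thesis by simp
  next
    case False
    then have Ft: "F t > 0" using F0[of t] t t0 by simp
    have Fs: "F s > 0" if "0 \<le> s" "s \<le> t" for s using dec[of s t] that Ft by simp
    let ?k = "\<gamma> * \<kappa> * A"
    have "- (F t powr (- \<gamma>)) + ?k * t \<le> - (F t0 powr (- \<gamma>)) + ?k * t0"
    proof (rule left_Dini_le_0_imp_decreasing[OF t])
      show "continuous_on {t0..t} (\<lambda>s. - (F s powr (- \<gamma>)) + ?k * s)"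
      proof -
        have "F s \<noteq> 0" if "s \<in> {t0..t}" for s using Fs[of s] t0 that by auto
        then show ?thesis using t0 by (intro continuous_intros cont') auto
      qed
      fix s assume s: "t0 < s" "s \<le> t"
      have Fs': "F s > 0" "F s \<le> Y" using Fs[of s] dec[of t0 s] F_t0 s t0 by auto
      have "A * F s powr \<gamma> \<le> A * Y powr \<gamma>"
        using Fs' pos by (intro mult_left_mono powr_mono2) auto
      then have "F s * (A * F s powr \<gamma>) \<le> F s * 1"
        unfolding Y\<gamma> using Fs' by (intro mult_left_mono) auto
      then have "A * F s powr (1 + \<gamma>) \<le> F s"
        using Fs' by (subst F_split) auto
      then have min: "min (F s) (A * F s powr (1 + \<gamma>)) = A * F s powr (1 + \<gamma>)" by simp
      have "((\<lambda>y. - (y powr (- \<gamma>))) has_real_derivative \<gamma> * F s powr (- \<gamma> - 1)) (at (F s))"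
        using Fs' by (auto intro!: derivative_eq_intros)
      then have "left_Dini_le (\<lambda>s. - (F s powr (- \<gamma>)))
          (\<gamma> * F s powr (- \<gamma> - 1) * - (\<kappa> * (A * F s powr (1 + \<gamma>)))) s"
        using Dini[of s] Fs' s t0 pos unfolding min
        by (intro left_Dini_le_compose[where \<psi> = "\<lambda>y. - (y powr (- \<gamma>))"] lim) auto
      also have "\<gamma> * F s powr (- \<gamma> - 1) * - (\<kappa> * (A * F s powr (1 + \<gamma>))) =
          - ?k * (F s powr (- \<gamma> - 1) * F s powr (1 + \<gamma>))" by simp
      also have "F s powr (- \<gamma> - 1) * F s powr (1 + \<gamma>) = 1"
        using Fs' by (simp add: powr_add[symmetric])
      finally have "left_Dini_le (\<lambda>s. - (F s powr (- \<gamma>)) + ?k * s) (- ?k * 1 + ?k) s"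
        by (rule left_Dini_le_add_linear)
      then show "left_Dini_le (\<lambda>s. - (F s powr (- \<gamma>)) + ?k * s) 0 s" by simp
    qed
    moreover have "F 0 powr (- \<gamma>) \<le> F t0 powr (- \<gamma>)"
      using dec[of 0 t0] Fs[of t0] t0 t pos by (intro powr_mono2') auto
    ultimately have le: "F 0 powr (- \<gamma>) + ?k * (t - t0) \<le> F t powr (- \<gamma>)"
      by (simp add: algebra_simps)
    have "F t = (F t powr (- \<gamma>)) powr (- (1 / \<gamma>))"
      using Ft pos by (simp add: powr_powr)
    also have "\<dots> \<le> (F 0 powr (- \<gamma>) + ?k * (t - t0)) powr (- (1 / \<gamma>))"
    proof (rule powr_mono2'[OF _ _ le])
      have "F 0 powr (- \<gamma>) > 0" using Fs[of 0] t0 t by simp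
      moreover have "?k * (t - t0) \<ge> 0" using pos t by simp
      ultimately show "0 < F 0 powr (- \<gamma>) + ?k * (t - t0)" by (rule add_pos_nonneg)
    qed (use pos in simp)
    finally show ?thesis .
  qed
qed

section \<open>Differentiable curves in \<open>L\<^sup>q\<close>\<close>

lemma Lp_norm_powr:
  "q > 0 \<Longrightarrow> Lp_norm q f powr q = (\<integral>x. \<bar>f x\<bar> powr q \<partial>lebesgue)"
  by (simp add: Lp_norm_def powr_powr)

lemma Lp_norm_nonneg: "Lp_norm q f \<ge> 0"
  by (simp add: Lp_norm_def)

lemma Lp_space_add:
  assumes f: "f \<in> Lp_space q" and g: "g \<in> Lp_space q" and q: "q \<ge> 0"
  shows "(\<lambda>x. f x + g x) \<in> Lp_space q"
    and "(\<integral>x. \<bar>f x + g x\<bar> powr q \<partial>lebesgue) \<le>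
      2 powr q * ((\<integral>x. \<bar>f x\<bar> powr q \<partial>lebesgue) + (\<integral>x. \<bar>g x\<bar> powr q \<partial>lebesgue))"
proof -
  have [measurable]: "f \<in> borel_measurable lebesgue" "g \<in> borel_measurable lebesgue"
    and int: "integrable lebesgue (\<lambda>x. \<bar>f x\<bar> powr q)" "integrable lebesgue (\<lambda>x. \<bar>g x\<bar> powr q)"
    using f g by (auto simp: Lp_space_def)
  have int': "integrable lebesgue (\<lambda>x. 2 powr q * (\<bar>f x\<bar> powr q + \<bar>g x\<bar> powr q))" using int by auto
  have le: "\<bar>f x + g x\<bar> powr q \<le> 2 powr q * (\<bar>f x\<bar> powr q + \<bar>g x\<bar> powr q)" for x
    using powr_add_le[OF q, of 1 "f x" "g x"] by (simp add: distrib_left)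
  have int_add: "integrable lebesgue (\<lambda>x. \<bar>f x + g x\<bar> powr q)"
    using le by (intro Bochner_Integration.integrable_bound[OF int']) auto
  then show "(\<lambda>x. f x + g x) \<in> Lp_space q" by (auto simp: Lp_space_def)
  have "(\<integral>x. \<bar>f x + g x\<bar> powr q \<partial>lebesgue) \<le> (\<integral>x. 2 powr q * (\<bar>f x\<bar> powr q + \<bar>g x\<bar> powr q) \<partial>lebesgue)"
    using le by (intro integral_mono int_add int') auto
  then show "(\<integral>x. \<bar>f x + g x\<bar> powr q \<partial>lebesgue) \<le>
      2 powr q * ((\<integral>x. \<bar>f x\<bar> powr q \<partial>lebesgue) + (\<integral>x. \<bar>g x\<bar> powr q \<partial>lebesgue))"
    using int by simp
qed

lemma Lp_space_cmult:
  assumes "f \<in> Lp_space q"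
  shows "(\<lambda>x. c * f x) \<in> Lp_space q"
  using assms by (auto simp: Lp_space_def abs_mult powr_mult)

lemma Lp_space_diff:
  assumes "f \<in> Lp_space q" "g \<in> Lp_space q" "q \<ge> 0"
  shows "(\<lambda>x. f x - g x) \<in> Lp_space q"
  using Lp_space_add(1)[OF assms(1) Lp_space_cmult[OF assms(2), of "-1"] assms(3)] by simp

lemma integrable_phi_mult:
  assumes f: "f \<in> Lp_space q" and g: "g \<in> Lp_space q" and q: "q \<ge> 1"
  shows "integrable lebesgue (\<lambda>x. phi (q - 1) (f x) * g x)"
proof -
  have [measurable]: "f \<in> borel_measurable lebesgue" "g \<in> borel_measurable lebesgue"
    and int: "integrable lebesgue (\<lambda>x. \<bar>f x\<bar> powr q)" "integrable lebesgue (\<lambda>x. \<bar>g x\<bar> powr q)"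
    using f g by (auto simp: Lp_space_def)
  have int': "integrable lebesgue (\<lambda>x. \<bar>f x\<bar> powr q + \<bar>g x\<bar> powr q)" using int by auto
  show ?thesis
    using phi_mult_le_Young[OF q, of 1 "f _" "g _"]
    by (intro Bochner_Integration.integrable_bound[OF int']) auto
qed

lemma integral_phi_mult_le:
  assumes f: "f \<in> Lp_space q" and g: "g \<in> Lp_space q" and q: "q \<ge> 1" and \<eta>: "\<eta> > 0"
  shows "\<bar>\<integral>x. phi (q - 1) (f x) * g x \<partial>lebesgue\<bar> \<le>
    \<eta> * (\<integral>x. \<bar>f x\<bar> powr q \<partial>lebesgue) + \<eta> powr (1 - q) * (\<integral>x. \<bar>g x\<bar> powr q \<partial>lebesgue)"
proof -
  have int: "integrable lebesgue (\<lambda>x. \<bar>f x\<bar> powr q)" "integrable lebesgue (\<lambda>x. \<bar>g x\<bar> powr q)"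
    using f g by (auto simp: Lp_space_def)
  have "\<bar>\<integral>x. phi (q - 1) (f x) * g x \<partial>lebesgue\<bar> \<le> (\<integral>x. \<bar>phi (q - 1) (f x) * g x\<bar> \<partial>lebesgue)"
    by (rule integral_abs_bound)
  also have "\<dots> \<le> (\<integral>x. \<eta> * \<bar>f x\<bar> powr q + \<eta> powr (1 - q) * \<bar>g x\<bar> powr q \<partial>lebesgue)"
    using int integrable_phi_mult[OF f g q] phi_mult_le_Young[OF q \<eta>]
    by (intro integral_mono) auto
  also have "\<dots> = \<eta> * (\<integral>x. \<bar>f x\<bar> powr q \<partial>lebesgue) + \<eta> powr (1 - q) * (\<integral>x. \<bar>g x\<bar> powr q \<partial>lebesgue)"
    using int by simp
  finally show ?thesis .
qed

lemma integral_powr_tangent: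
  assumes f: "f \<in> Lp_space q" and g: "g \<in> Lp_space q" and q: "q \<ge> 1"
  shows "(\<integral>x. \<bar>f x\<bar> powr q \<partial>lebesgue) - (\<integral>x. \<bar>g x\<bar> powr q \<partial>lebesgue) \<le>
    q * (\<integral>x. phi (q - 1) (f x) * (f x - g x) \<partial>lebesgue)"
proof -
  have int: "integrable lebesgue (\<lambda>x. \<bar>f x\<bar> powr q)" "integrable lebesgue (\<lambda>x. \<bar>g x\<bar> powr q)"
    using f g by (auto simp: Lp_space_def)
  have int': "integrable lebesgue (\<lambda>x. phi (q - 1) (f x) * (f x - g x))"
    using q by (intro integrable_phi_mult Lp_space_diff f g) auto
  have "(\<integral>x. \<bar>f x\<bar> powr q - \<bar>g x\<bar> powr q \<partial>lebesgue) \<le>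
      (\<integral>x. q * (phi (q - 1) (f x) * (f x - g x)) \<partial>lebesgue)"
  proof (intro integral_mono)
    fix x
    show "\<bar>f x\<bar> powr q - \<bar>g x\<bar> powr q \<le> q * (phi (q - 1) (f x) * (f x - g x))"
      using powr_above_tangent[OF q, of "f x" "g x"] by (simp add: algebra_simps)
  qed (use int int' in auto)
  then show ?thesis using int int' by simp
qed

lemma integral_powr_perturb:
  assumes f: "f \<in> Lp_space q" and g: "g \<in> Lp_space q" and q: "q \<ge> 0" and \<delta>: "\<delta> > 0"
  shows "(\<integral>x. \<bar>f x\<bar> powr q \<partial>lebesgue) \<le> (1 + \<delta>) powr q * (\<integral>x. \<bar>g x\<bar> powr q \<partial>lebesgue)
    + (1 + 1 / \<delta>) powr q * (\<integral>x. \<bar>f x - g x\<bar> powr q \<partial>lebesgue)"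
proof -
  have int: "integrable lebesgue (\<lambda>x. \<bar>f x\<bar> powr q)" "integrable lebesgue (\<lambda>x. \<bar>g x\<bar> powr q)"
    "integrable lebesgue (\<lambda>x. \<bar>f x - g x\<bar> powr q)"
    using f g Lp_space_diff[OF f g q] by (auto simp: Lp_space_def)
  have "(\<integral>x. \<bar>f x\<bar> powr q \<partial>lebesgue) \<le>
     (\<integral>x. (1 + \<delta>) powr q * \<bar>g x\<bar> powr q + (1 + 1 / \<delta>) powr q * \<bar>f x - g x\<bar> powr q \<partial>lebesgue)"
  proof (intro integral_mono)
    fix x
    show "\<bar>f x\<bar> powr q \<le> (1 + \<delta>) powr q * \<bar>g x\<bar> powr q + (1 + 1 / \<delta>) powr q * \<bar>f x - g x\<bar> powr q"
      using powr_add_le[OF q \<delta>, of "g x" "f x - g x"] by simp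
  qed (use int in auto)
  also have "\<dots> = (1 + \<delta>) powr q * (\<integral>x. \<bar>g x\<bar> powr q \<partial>lebesgue)
    + (1 + 1 / \<delta>) powr q * (\<integral>x. \<bar>f x - g x\<bar> powr q \<partial>lebesgue)"
    using int by simp
  finally show ?thesis .
qed

text \<open>Continuity from the perturbation estimate, which replaces Minkowski's inequality here.\<close>

lemma tendsto_of_perturb:
  fixes G D :: "real \<Rightarrow> real"
  assumes D: "(D \<longlongrightarrow> 0) \<F>"
    and up: "\<And>\<delta>. \<delta> > 0 \<Longrightarrow> \<forall>\<^sub>F s in \<F>. G s \<le> (1 + \<delta>) powr q * g + (1 + 1 / \<delta>) powr q * D s"
    and lo: "\<And>\<delta>. \<delta> > 0 \<Longrightarrow> \<forall>\<^sub>F s in \<F>. g \<le> (1 + \<delta>) powr q * G s + (1 + 1 / \<delta>) powr q * D s"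
  shows "(G \<longlongrightarrow> g) \<F>"
proof (rule order_tendstoI)
  have ex: "\<exists>\<delta>>0. (1 + \<delta>) powr q * a < b" if "a < b" for a b :: real
  proof -
    have "((\<lambda>\<delta>. (1 + \<delta>) powr q * a) \<longlongrightarrow> (1 + 0) powr q * a) (at_right (0::real))"
      by (intro tendsto_intros) auto
    then have "\<forall>\<^sub>F \<delta> in at_right 0. (1 + \<delta>) powr q * a < b"
      using that by (intro order_tendstoD(2)[where a = b]) auto
    moreover have "\<forall>\<^sub>F \<delta> in at_right (0::real). \<delta> > 0" by (simp add: eventually_at_filter)
    ultimately have "\<forall>\<^sub>F \<delta> in at_right (0::real). \<delta> > 0 \<and> (1 + \<delta>) powr q * a < b"
      by eventually_elim simp
    then show ?thesis using eventually_happens'[of "at_right (0::real)"] by auto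
  qed
  have lim: "((\<lambda>s. c * D s) \<longlongrightarrow> 0) \<F>" for c
    using tendsto_mult_left[OF D, of c] by simp
  fix a
  show "\<forall>\<^sub>F s in \<F>. a < G s" if a: "a < g"
  proof -
    obtain \<delta> where \<delta>: "\<delta> > 0" "(1 + \<delta>) powr q * a < g" using ex[OF a] by blast
    then have "\<forall>\<^sub>F s in \<F>. (1 + 1 / \<delta>) powr q * D s < g - (1 + \<delta>) powr q * a"
      by (intro order_tendstoD(2)[OF lim]) auto
    then show ?thesis using lo[OF \<delta>(1)]
    proof eventually_elim
      case (elim s)
      then have "(1 + \<delta>) powr q * a < (1 + \<delta>) powr q * G s" by linarith
      then show ?case using \<delta> by (simp add: mult_less_cancel_left)
    qed
  qed
  show "\<forall>\<^sub>F s in \<F>. G s < a" if a: "g < a"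
  proof -
    obtain \<delta> where \<delta>: "\<delta> > 0" "(1 + \<delta>) powr q * g < a" using ex[OF a] by blast
    then have "\<forall>\<^sub>F s in \<F>. (1 + 1 / \<delta>) powr q * D s < a - (1 + \<delta>) powr q * g"
      by (intro order_tendstoD(2)[OF lim]) auto
    then show ?thesis using up[OF \<delta>(1)] by eventually_elim linarith
  qed
qed

text \<open>A curve \<open>u\<close> in \<open>L\<^sup>q\<close> on \<open>[0, \<infinity>)\<close> with strong derivative \<open>v\<close>.\<close>

locale Lp_curve =
  fixes q :: real and u v :: "real \<Rightarrow> 'a::euclidean_space \<Rightarrow> real"
  assumes q: "q \<ge> 1"
    and u: "\<And>t. t \<ge> 0 \<Longrightarrow> u t \<in> Lp_space q" and v: "\<And>t. t \<ge> 0 \<Longrightarrow> v t \<in> Lp_space q"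
    and deriv: "\<And>t. t \<ge> 0 \<Longrightarrow>
      ((\<lambda>s. Lp_norm q (\<lambda>x. (u s x - u t x) / (s - t) - v t x)) \<longlongrightarrow> 0) (at t within {0..})"
begin

text \<open>The error of the difference quotient.\<close>

abbreviation err :: "real \<Rightarrow> real \<Rightarrow> 'a \<Rightarrow> real" where
  "err t s \<equiv> (\<lambda>x. (u s x - u t x) / (s - t) - v t x)"

lemma err_in_Lp: "t \<ge> 0 \<Longrightarrow> s \<ge> 0 \<Longrightarrow> err t s \<in> Lp_space q"
  using Lp_space_diff[OF Lp_space_cmult[OF Lp_space_diff[OF u u], of s t "1 / (s - t)"] v, of t] q
  by simp

lemma err_tendsto:
  assumes "t \<ge> 0"
  shows "((\<lambda>s. \<integral>x. \<bar>err t s x\<bar> powr q \<partial>lebesgue) \<longlongrightarrow> 0) (at t within {0..})"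
proof -
  have "((\<lambda>s. Lp_norm q (err t s) powr q) \<longlongrightarrow> 0 powr q) (at t within {0..})"
    using q by (intro tendsto_powr'[OF deriv[OF assms] tendsto_const]) (auto simp: Lp_norm_nonneg)
  then show ?thesis using q by (simp add: Lp_norm_powr)
qed

lemma diff_tendsto:
  assumes t: "t \<ge> 0"
  shows "((\<lambda>s. \<integral>x. \<bar>u s x - u t x\<bar> powr q \<partial>lebesgue) \<longlongrightarrow> 0) (at t within {0..})"
proof (rule tendsto_sandwich[OF _ _ tendsto_const])
  let ?b = "\<lambda>s. \<bar>s - t\<bar> powr q * (2 powr q * ((\<integral>x. \<bar>err t s x\<bar> powr q \<partial>lebesgue)
      + (\<integral>x. \<bar>v t x\<bar> powr q \<partial>lebesgue)))"
  show "\<forall>\<^sub>F s in at t within {0..}. 0 \<le> (\<integral>x. \<bar>u s x - u t x\<bar> powr q \<partial>lebesgue)" by simp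
  show "\<forall>\<^sub>F s in at t within {0..}. (\<integral>x. \<bar>u s x - u t x\<bar> powr q \<partial>lebesgue) \<le> ?b s"
    unfolding eventually_at_filter
  proof (intro always_eventually allI impI)
    fix s assume s: "s \<noteq> t" "s \<in> {0..}"
    have "\<bar>u s x - u t x\<bar> powr q = \<bar>s - t\<bar> powr q * \<bar>err t s x + v t x\<bar> powr q" for x
    proof -
      have "u s x - u t x = (s - t) * (err t s x + v t x)" using s by simp
      then show ?thesis by (metis abs_mult powr_mult)
    qed
    then have "(\<integral>x. \<bar>u s x - u t x\<bar> powr q \<partial>lebesgue) =
        \<bar>s - t\<bar> powr q * (\<integral>x. \<bar>err t s x + v t x\<bar> powr q \<partial>lebesgue)" by simp
    also have "\<dots> \<le> ?b s"
      using s t q by (intro mult_left_mono Lp_space_add err_in_Lp v) auto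
    finally show "(\<integral>x. \<bar>u s x - u t x\<bar> powr q \<partial>lebesgue) \<le> ?b s" .
  qed
  have "((\<lambda>s. \<bar>s - t\<bar>) \<longlongrightarrow> \<bar>t - t\<bar>) (at t within {0..})" by (intro tendsto_intros)
  then have "((\<lambda>s. \<bar>s - t\<bar> powr q) \<longlongrightarrow> \<bar>t - t\<bar> powr q) (at t within {0..})"
    using q by (intro tendsto_powr'[OF _ tendsto_const]) auto
  from tendsto_mult[OF this tendsto_mult[OF tendsto_const[of "2 powr q"]
      tendsto_add[OF err_tendsto[OF t] tendsto_const[of "\<integral>x. \<bar>v t x\<bar> powr q \<partial>lebesgue"]]]]
  show "(?b \<longlongrightarrow> 0) (at t within {0..})" by simp
qed

lemma continuous_on_integral_powr: "continuous_on {0..} (\<lambda>t. \<integral>x. \<bar>u t x\<bar> powr q \<partial>lebesgue)"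
  unfolding continuous_on_def
proof
  fix t :: real assume "t \<in> {0..}"
  then have t: "t \<ge> 0" by simp
  have nonneg: "\<forall>\<^sub>F s in at t within {0..}. s \<ge> 0" by (simp add: eventually_at_filter)
  show "((\<lambda>t. \<integral>x. \<bar>u t x\<bar> powr q \<partial>lebesgue) \<longlongrightarrow> (\<integral>x. \<bar>u t x\<bar> powr q \<partial>lebesgue)) (at t within {0..})"
  proof (rule tendsto_of_perturb[OF diff_tendsto[OF t], where q = q])
    fix \<delta> :: real assume \<delta>: "\<delta> > 0"
    show "\<forall>\<^sub>F s in at t within {0..}. (\<integral>x. \<bar>u s x\<bar> powr q \<partial>lebesgue) \<le>
        (1 + \<delta>) powr q * (\<integral>x. \<bar>u t x\<bar> powr q \<partial>lebesgue)
        + (1 + 1 / \<delta>) powr q * (\<integral>x. \<bar>u s x - u t x\<bar> powr q \<partial>lebesgue)"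
      using nonneg
    proof eventually_elim
      case (elim s)
      then show ?case using q \<delta> t by (intro integral_powr_perturb u) auto
    qed
    show "\<forall>\<^sub>F s in at t within {0..}. (\<integral>x. \<bar>u t x\<bar> powr q \<partial>lebesgue) \<le>
        (1 + \<delta>) powr q * (\<integral>x. \<bar>u s x\<bar> powr q \<partial>lebesgue)
        + (1 + 1 / \<delta>) powr q * (\<integral>x. \<bar>u s x - u t x\<bar> powr q \<partial>lebesgue)"
      using nonneg
    proof eventually_elim
      case (elim s)
      then show ?case
        using integral_powr_perturb[OF u u, of t s \<delta>] q \<delta> t by (simp add: abs_minus_commute)
    qed
  qed
qed

text \<open>Only left difference quotients are used: the convexity inequality then involves
  \<open>phi (q - 1) (u t)\<close> at the fixed time \<open>t\<close>.\<close>

lemma left_Dini_integral_powr: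
  assumes t: "t > 0"
  shows "left_Dini_le (\<lambda>t. \<integral>x. \<bar>u t x\<bar> powr q \<partial>lebesgue)
    (q * (\<integral>x. phi (q - 1) (u t x) * v t x \<partial>lebesgue)) t"
  unfolding left_Dini_le_def
proof (intro allI impI)
  fix \<epsilon> :: real assume \<epsilon>: "\<epsilon> > 0"
  let ?G = "\<lambda>t. \<integral>x. \<bar>u t x\<bar> powr q \<partial>lebesgue"
  let ?e = "\<lambda>s. \<integral>x. \<bar>err t s x\<bar> powr q \<partial>lebesgue"
  \<comment> \<open>The parameter of Young's inequality; the summand \<open>1\<close> avoids a division by zero.\<close>
  define X where "X = ?G t + 1"
  define \<eta> where "\<eta> = \<epsilon> / (2 * q * X)"
  have X: "X > 0" unfolding X_def by (intro add_nonneg_pos) auto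
  have \<eta>: "\<eta> > 0" using \<epsilon> q X by (simp add: \<eta>_def)
  have "q * \<eta> * ?G t \<le> q * \<eta> * X" using q \<eta> by (intro mult_left_mono) (auto simp: X_def)
  also have "\<dots> = \<epsilon> / 2" using q X by (simp add: \<eta>_def)
  finally have \<eta>G: "q * \<eta> * ?G t \<le> \<epsilon> / 2" .
  have "((\<lambda>s. q * \<eta> powr (1 - q) * ?e s) \<longlongrightarrow> q * \<eta> powr (1 - q) * 0) (at t within {0..})"
    using t by (intro tendsto_mult_left err_tendsto) simp
  then have "\<forall>\<^sub>F s in at t within {0..}. q * \<eta> powr (1 - q) * ?e s < \<epsilon> / 2"
    using \<epsilon> by (intro order_tendstoD(2)) auto
  moreover have "at_left t \<le> at t within {0..}"
  proof -
    have "at t within {0..} = at t"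
      using t by (intro at_within_interior) simp
    then show ?thesis by (simp add: at_le)
  qed
  ultimately have "\<forall>\<^sub>F s in at_left t. q * \<eta> powr (1 - q) * ?e s < \<epsilon> / 2"
    by (rule filter_leD[rotated])
  moreover have "\<forall>\<^sub>F s in at_left t. s \<in> {0<..<t}" by (rule eventually_at_left_real[OF t])
  ultimately show "\<forall>\<^sub>F s in at_left t. ?G t - ?G s \<le>
      (q * (\<integral>x. phi (q - 1) (u t x) * v t x \<partial>lebesgue) + \<epsilon>) * (t - s)"
  proof eventually_elim
    case (elim s)
    then have s: "0 < s" "s < t" by auto
    have e: "err t s \<in> Lp_space q" using s t by (intro err_in_Lp) auto
    have "phi (q - 1) (u t x) * (u t x - u s x) =
        (t - s) * (phi (q - 1) (u t x) * v t x + phi (q - 1) (u t x) * err t s x)" for x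
    proof -
      have "u t x - u s x = (t - s) * (v t x + err t s x)"
        using s by (simp add: field_simps)
      moreover have "c * d = k * (c * a + c * b)" if "d = k * (a + b)" for a b c d k :: real
        using that by (simp add: algebra_simps)
      ultimately show ?thesis by blast
    qed
    then have I1: "(\<integral>x. phi (q - 1) (u t x) * (u t x - u s x) \<partial>lebesgue) =
        (t - s) * ((\<integral>x. phi (q - 1) (u t x) * v t x \<partial>lebesgue)
          + (\<integral>x. phi (q - 1) (u t x) * err t s x \<partial>lebesgue))"
      using integrable_phi_mult[OF u v q, of t t] integrable_phi_mult[OF u e q, of t] t
      by (simp del: diff_divide_distrib)
    have I2: "?G t - ?G s \<le> q * (\<integral>x. phi (q - 1) (u t x) * (u t x - u s x) \<partial>lebesgue)"
      using s t q by (intro integral_powr_tangent u) auto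
    have I3: "q * (\<integral>x. phi (q - 1) (u t x) * err t s x \<partial>lebesgue) \<le> \<epsilon>"
    proof -
      have "q * (\<integral>x. phi (q - 1) (u t x) * err t s x \<partial>lebesgue) \<le>
          q * (\<eta> * ?G t + \<eta> powr (1 - q) * ?e s)"
        using integral_phi_mult_le[OF u e q \<eta>, of t] t q by (intro mult_left_mono) auto
      also have "\<dots> = q * \<eta> * ?G t + q * \<eta> powr (1 - q) * ?e s" by (simp add: algebra_simps)
      finally show ?thesis using \<eta>G elim by linarith
    qed
    have alg: "q * (k * (a + b)) = (q * a + q * b) * k" for k a b :: real
      by (simp add: algebra_simps)
    show ?case
      using I2 unfolding I1 alg
      by (rule order_trans) (use I3 s in \<open>intro mult_right_mono add_left_mono, auto\<close>)
  qed
qed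

end

section \<open>Energy inequality and decay for functions in \<open>L\<^sup>1 \<inter> L\<^sup>p\<close>\<close>

lemma Lp_norm_1: "Lp_norm 1 f = (\<integral>x. \<bar>f x\<bar> powr 1 \<partial>lebesgue)"
  by (simp add: Lp_norm_def)

lemma Lp_norm_cong_AE:
  fixes f g :: "'a::euclidean_space \<Rightarrow> real"
  assumes "f \<in> borel_measurable lebesgue" "g \<in> borel_measurable lebesgue" "AE x in lebesgue. f x = g x"
  shows "Lp_norm q f = Lp_norm q g"
proof -
  have "(\<integral>x. \<bar>f x\<bar> powr q \<partial>lebesgue) = (\<integral>x. \<bar>g x\<bar> powr q \<partial>lebesgue)"
    using assms(1,2) by (intro integral_cong_AE) (auto intro: AE_mp[OF assms(3)])
  then show ?thesis by (simp add: Lp_norm_def)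
qed

lemma Lp_norm_1_eq_0_imp:
  assumes f: "f \<in> Lp_space 1" and 0: "Lp_norm 1 f = 0"
  shows "Lp_norm q f = 0"
proof -
  have "integrable lebesgue (\<lambda>x. \<bar>f x\<bar> powr 1)" using f by (simp add: Lp_space_def)
  then have "AE x in lebesgue. \<bar>f x\<bar> powr 1 = 0"
    using 0 by (subst (asm) Lp_norm_1, subst (asm) integral_nonneg_eq_0_iff_AE) auto
  then have "AE x in lebesgue. f x = 0" by eventually_elim simp
  then show ?thesis
    using Lp_norm_cong_AE[of f "\<lambda>_. 0" q] f by (simp add: Lp_space_def Lp_norm_def)
qed

lemma energy_inequality_ball_Lp:
  fixes w :: "'a::euclidean_space \<Rightarrow> real" and p \<gamma> R :: real
  defines "\<gamma> \<equiv> 2 / (real DIM('a) * (p - 1))"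
  assumes w: "w \<in> Lp_space 1" "w \<in> Lp_space p" and p: "p \<ge> 2" and R: "R > 0"
  shows "ennreal (energy_const TYPE('a) p *
      min (R ^ (DIM('a) + 2) * Lp_norm 1 w powr (- (p * \<gamma>)) * (Lp_norm p w powr p) powr (1 + \<gamma>))
        (R ^ DIM('a) * Lp_norm p w powr p))
    \<le> energy p (indicator (ball 0 R)) w"
proof -
  have "w \<in> borel_measurable lebesgue" using w by (simp add: Lp_space_def)
  then obtain w' where w': "w' \<in> borel_measurable borel" and ae: "AE x in lborel. w x = w' x"
    and norm: "\<And>q. (\<integral>x. \<bar>w x\<bar> powr q \<partial>lebesgue) = (\<integral>x. \<bar>w' x\<bar> powr q \<partial>lborel)"
    and space: "\<And>q. w \<in> Lp_space q \<longleftrightarrow> integrable lborel (\<lambda>x. \<bar>w' x\<bar> powr q)"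
    by (rule Lp_space_borel_representative) blast
  have nn: "(\<integral>\<^sup>+x. ennreal (\<bar>w' x\<bar> powr q) \<partial>lborel) = ennreal (\<integral>x. \<bar>w x\<bar> powr q \<partial>lebesgue)"
    if "w \<in> Lp_space q" for q
    using that unfolding norm space by (intro nn_integral_eq_integral) auto
  have M1: "(\<integral>\<^sup>+x. ennreal \<bar>w' x\<bar> \<partial>lborel) = ennreal (Lp_norm 1 w)"
    using nn[OF w(1)] by (simp add: Lp_norm_1)
  have Mp: "(\<integral>\<^sup>+x. ennreal (\<bar>w' x\<bar> powr p) \<partial>lborel) = ennreal (Lp_norm p w powr p)"
    using nn[OF w(2)] p by (simp add: Lp_norm_powr)
  show ?thesis
    unfolding energy_cong_AE[OF ae] \<gamma>_def
    by (rule energy_inequality_ball[OF w' p M1 Lp_norm_nonneg Mp powr_ge_zero R])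
qed

lemma energy_inequality:
  fixes J w :: "'a::euclidean_space \<Rightarrow> real" and p \<gamma> r R :: real
  defines "\<gamma> \<equiv> 2 / (real DIM('a) * (p - 1))"
  assumes p: "p \<ge> 2" and r: "r > 0" and R: "R > 0"
    and J0: "\<And>z. 0 \<le> J z" and Jr: "\<And>z. norm z < R \<Longrightarrow> r \<le> J z"
    and w: "w \<in> Lp_space 1 \<inter> Lp_space p"
  shows "ennreal (energy_const TYPE('a) p * r *
      min (R ^ (DIM('a) + 2) * Lp_norm 1 w powr (- (p * \<gamma>)) * Lp_norm p w powr (p * (1 + \<gamma>)))
        (R ^ DIM('a) * Lp_norm p w powr p))
    \<le> energy p J w"
proof -
  let ?m = "min (R ^ (DIM('a) + 2) * Lp_norm 1 w powr (- (p * \<gamma>)) * (Lp_norm p w powr p) powr (1 + \<gamma>))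
        (R ^ DIM('a) * Lp_norm p w powr p)"
  have "w \<in> borel_measurable lebesgue" using w by (simp add: Lp_space_def)
  then obtain w' where w': "w' \<in> borel_measurable borel" and ae: "AE x in lborel. w x = w' x"
    by (rule Lp_space_borel_representative) blast
  have "ennreal (energy_const TYPE('a) p * r * ?m) = ennreal (r * (energy_const TYPE('a) p * ?m))"
    by (simp only: ac_simps)
  also have "\<dots> = ennreal r * ennreal (energy_const TYPE('a) p * ?m)"
    using r by (intro ennreal_mult') simp
  also have "\<dots> \<le> ennreal r * energy p (indicator (ball 0 R)) w"
    unfolding \<gamma>_def using w p R by (intro mult_left_mono energy_inequality_ball_Lp) auto
  also have "\<dots> = ennreal r * energy p (indicator (ball 0 R)) w'"
    by (simp only: energy_cong_AE[OF ae])
  also have "\<dots> \<le> energy p J w'"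
    using w' p r J0 Jr by (intro energy_kernel_mono) (auto simp: indicator_def)
  also have "\<dots> = energy p J w" by (rule energy_cong_AE[OF ae, symmetric])
  finally show ?thesis by (simp only: powr_powr)
qed

lemma Lp_curve_of_C1_curve:
  assumes "C1_curve p u v" "p \<ge> 1" "q \<in> {1, p}"
  shows "Lp_curve q u v"
proof
  have q: "q \<ge> 1" using assms by auto
  then show "1 \<le> q" .
  show "u t \<in> Lp_space q" "v t \<in> Lp_space q" if "t \<ge> 0" for t
    using assms that by (auto simp: C1_curve_def L1p_space_def)
  fix t :: real assume t: "t \<ge> 0"
  let ?e = "\<lambda>s x. (u s x - u t x) / (s - t) - v t x"
  show "((\<lambda>s. Lp_norm q (?e s)) \<longlongrightarrow> 0) (at t within {0..})"
  proof (rule tendsto_sandwich[OF _ _ tendsto_const])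
    show "((\<lambda>s. L1p_norm p (?e s)) \<longlongrightarrow> 0) (at t within {0..})"
      using assms t by (auto simp: C1_curve_def)
    show "\<forall>\<^sub>F s in at t within {0..}. Lp_norm q (?e s) \<le> L1p_norm p (?e s)"
      using assms(3) Lp_norm_nonneg by (auto simp: L1p_norm_def intro!: always_eventually)
  qed (simp add: Lp_norm_nonneg)
qed

text \<open>For \<open>q = 1\<close> the dissipation identity says that the \<open>L\<^sup>1\<close> norm does not increase; for \<open>q = p\<close>,
  combined with the energy inequality, it yields a closed differential inequality for the
  \<open>p\<close>-th power of the \<open>L\<^sup>p\<close> norm.\<close>

lemma nonlocal_diffusion_decay:
  fixes J u0 :: "'a::euclidean_space \<Rightarrow> real" and u :: "real \<Rightarrow> 'a \<Rightarrow> real" and p \<gamma> r R :: real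
  defines "\<gamma> \<equiv> 2 / (real DIM('a) * (p - 1))" and "C \<equiv> energy_const TYPE('a) p"
  assumes p: "p \<ge> 2" and r: "r > 0" and R: "R > 0"
    and J: "J \<in> Lp_space 1" and J0: "\<And>z. 0 \<le> J z" and Jr: "\<And>z. norm z < R \<Longrightarrow> r \<le> J z"
    and u0: "u0 \<in> Lp_space 1 \<inter> Lp_space p" and sol: "is_solution p J u0 u"
  defines "t0 \<equiv> max 0 (1 / (C * r * R ^ DIM('a)) *
      ln (R powr (2 / \<gamma>) * Lp_norm 1 u0 powr (- p) * Lp_norm p u0 powr p))"
  shows "\<And>t. 0 \<le> t \<Longrightarrow> Lp_norm p (u t) powr p \<le> Lp_norm p u0 powr p"
    and "\<And>t. t0 \<le> t \<Longrightarrow> Lp_norm p (u t) powr p \<le>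
      (Lp_norm p u0 powr (- (p * \<gamma>))
       + C * \<gamma> * r * R ^ (DIM('a) + 2) * Lp_norm 1 u0 powr (- (p * \<gamma>)) * (t - t0))
      powr (- (1 / \<gamma>))"
proof -
  obtain v where C1: "C1_curve p u v"
    and v: "\<And>t. t \<ge> 0 \<Longrightarrow> AE x in lebesgue. v t x = (\<integral>y. J (x - y) * (u t y - u t x) \<partial>lebesgue)"
    and init: "AE x in lebesgue. u 0 x = u0 x"
    using sol unfolding is_solution_def by blast
  interpret c1: Lp_curve 1 u v using p by (intro Lp_curve_of_C1_curve[OF C1]) auto
  interpret cp: Lp_curve p u v using p by (intro Lp_curve_of_C1_curve[OF C1]) auto
  have C: "C > 0" unfolding C_def by (rule energy_const_pos)
  have \<gamma>: "\<gamma> > 0" using p by (simp add: \<gamma>_def)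
  have Jr': "r * indicator (ball 0 R) z \<le> J z" for z
    using J0 Jr by (simp add: indicator_def)
  define M where "M = Lp_norm 1 u0"
  define F where "F t = Lp_norm p (u t) powr p" for t
  have F_eq: "F t = (\<integral>x. \<bar>u t x\<bar> powr p \<partial>lebesgue)" for t
    using p by (simp add: F_def Lp_norm_powr)
  have meas: "u 0 \<in> borel_measurable lebesgue" "u0 \<in> borel_measurable lebesgue"
    using c1.u[of 0] u0 by (auto simp: Lp_space_def)
  have F0: "F 0 = Lp_norm p u0 powr p" and M_eq: "M = Lp_norm 1 (u 0)"
    unfolding F_def M_def using Lp_norm_cong_AE[OF meas init] by simp_all
  have L1_dec: "Lp_norm 1 (u t) \<le> M" if t: "t \<ge> 0" for t
    unfolding M_eq Lp_norm_1
  proof (rule left_Dini_le_0_imp_decreasing[OF t])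
    show "continuous_on {0..t} (\<lambda>t. \<integral>x. \<bar>u t x\<bar> powr 1 \<partial>lebesgue)"
      by (rule continuous_on_subset[OF c1.continuous_on_integral_powr]) auto
    fix s :: real assume "0 < s"
    then show "left_Dini_le (\<lambda>t. \<integral>x. \<bar>u t x\<bar> powr 1 \<partial>lebesgue) 0 s"
      using dissipation_lebesgue(1)[OF _ J less_imp_le[OF r] Jr' c1.u v, of s]
      by (intro left_Dini_le_weaken[OF c1.left_Dini_integral_powr]) auto
  qed
  have Dini: "left_Dini_le F (- (r * (C *
      min (R ^ (DIM('a) + 2) * Lp_norm 1 (u t) powr (- (p * \<gamma>)) * F t powr (1 + \<gamma>)) (R ^ DIM('a) * F t)))) t"
    if t: "t > 0" for t
  proof -
    let ?m = "min (R ^ (DIM('a) + 2) * Lp_norm 1 (u t) powr (- (p * \<gamma>)) * F t powr (1 + \<gamma>)) (R ^ DIM('a) * F t)"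
    let ?I = "- p * (\<integral>x. phi (p - 1) (u t x) * v t x \<partial>lebesgue)"
    have I: "?I \<ge> 0" "ennreal r * energy p (indicator (ball 0 R)) (u t) \<le> ennreal ?I"
      using dissipation_lebesgue[OF _ J less_imp_le[OF r] Jr' cp.u v, of t] p t by auto
    have "ennreal (r * (C * ?m)) = ennreal r * ennreal (C * ?m)"
      using r by (intro ennreal_mult') simp
    also have "\<dots> \<le> ennreal r * energy p (indicator (ball 0 R)) (u t)"
      unfolding F_def C_def \<gamma>_def using t p R
      by (intro mult_left_mono energy_inequality_ball_Lp c1.u cp.u) auto
    also have "\<dots> \<le> ennreal ?I" by (rule I)
    finally have "r * (C * ?m) \<le> ?I" using I(1) by (simp add: ennreal_le_iff)
    then show ?thesis
      unfolding F_eq[abs_def] by (intro left_Dini_le_weaken[OF cp.left_Dini_integral_powr[OF t]]) simp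
  qed
  have "\<And>t. 0 \<le> t \<Longrightarrow> F t \<le> F 0" and "\<And>t. t0 \<le> t \<Longrightarrow> F t \<le>
      (F 0 powr (- \<gamma>) + C * \<gamma> * r * R ^ (DIM('a) + 2) * M powr (- (p * \<gamma>)) * (t - t0)) powr (- (1 / \<gamma>))"
  proof -
    have t0: "t0 \<ge> 0" by (simp add: t0_def)
    consider "M = 0" | "M > 0" unfolding M_def using Lp_norm_nonneg[of 1 u0] by linarith
    then have "(\<forall>t\<ge>0. F t \<le> F 0) \<and> (\<forall>t\<ge>t0. F t \<le>
      (F 0 powr (- \<gamma>) + C * \<gamma> * r * R ^ (DIM('a) + 2) * M powr (- (p * \<gamma>)) * (t - t0)) powr (- (1 / \<gamma>)))"
    proof cases
      \<comment> \<open>The rate vanishes here because \<open>0 powr a = 0\<close>, but so does the solution.\<close>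
      case 1
      have "F t = 0" if "t \<ge> 0" for t
      proof -
        have "Lp_norm 1 (u t) = 0" using L1_dec[OF that] Lp_norm_nonneg[of 1 "u t"] 1 by simp
        then show ?thesis using Lp_norm_1_eq_0_imp[OF c1.u[OF that]] by (simp add: F_def)
      qed
      then show ?thesis using t0 by simp
    next
      case M: 2
      define \<kappa> where "\<kappa> = C * r * R ^ DIM('a)"
      define A where "A = R\<^sup>2 * M powr (- (p * \<gamma>))"
      have pos: "\<kappa> > 0" "A > 0" using C r R M by (auto simp: \<kappa>_def A_def)
      have A_root: "A powr (1 / \<gamma>) = R powr (2 / \<gamma>) * M powr (- p)"
      proof -
        have "A = R powr 2 * M powr (- (p * \<gamma>))" using R by (simp add: A_def powr_numeral)
        then show ?thesis using \<gamma> by (simp add: powr_mult powr_powr)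
      qed
      have Dini': "left_Dini_le F (- (\<kappa> * min (F t) (A * F t powr (1 + \<gamma>)))) t" if t: "t > 0" for t
      proof (rule left_Dini_le_weaken[OF Dini[OF t]])
        let ?L = "Lp_norm 1 (u t)"
        have eq: "\<kappa> * min (F t) (A * F t powr (1 + \<gamma>)) = r * (C *
            min (R ^ (DIM('a) + 2) * M powr (- (p * \<gamma>)) * F t powr (1 + \<gamma>)) (R ^ DIM('a) * F t))"
        proof -
          have "R ^ DIM('a) * min (F t) (A * F t powr (1 + \<gamma>)) =
              min (R ^ DIM('a) * F t) (R ^ DIM('a) * (A * F t powr (1 + \<gamma>)))"
            using R by (simp add: min_mult_distrib_left)
          then show ?thesis by (simp add: \<kappa>_def A_def power_add power2_eq_square min.commute ac_simps)
        qed
        have "R ^ (DIM('a) + 2) * M powr (- (p * \<gamma>)) * F t powr (1 + \<gamma>) \<le>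
            R ^ (DIM('a) + 2) * ?L powr (- (p * \<gamma>)) * F t powr (1 + \<gamma>)"
        proof (cases "?L = 0")
          case True
          then have "F t = 0" using Lp_norm_1_eq_0_imp[OF c1.u, of t] t by (simp add: F_def)
          then show ?thesis by simp
        next
          case False
          then have "?L > 0" using Lp_norm_nonneg[of 1 "u t"] by linarith
          then have "M powr (- (p * \<gamma>)) \<le> ?L powr (- (p * \<gamma>))"
            using L1_dec[of t] t p \<gamma> by (intro powr_mono2') auto
          then show ?thesis using R by (intro mult_right_mono mult_left_mono) auto
        qed
        then have "r * (C * min (R ^ (DIM('a) + 2) * M powr (- (p * \<gamma>)) * F t powr (1 + \<gamma>)) (R ^ DIM('a) * F t))
          \<le> r * (C * min (R ^ (DIM('a) + 2) * ?L powr (- (p * \<gamma>)) * F t powr (1 + \<gamma>)) (R ^ DIM('a) * F t))"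
          using r C by (intro mult_left_mono min.mono[OF _ order_refl]) auto
        then show "- (r * (C * min (R ^ (DIM('a) + 2) * ?L powr (- (p * \<gamma>)) * F t powr (1 + \<gamma>)) (R ^ DIM('a) * F t)))
          \<le> - (\<kappa> * min (F t) (A * F t powr (1 + \<gamma>)))"
          unfolding eq by simp
      qed
      have cont: "continuous_on {0..} F"
        unfolding F_eq[abs_def] by (rule cp.continuous_on_integral_powr)
      have t0_eq: "t0 = max 0 (1 / \<kappa> * ln (A powr (1 / \<gamma>) * F 0))"
        unfolding t0_def \<kappa>_def A_root F0 M_def ..
      have rate: "\<gamma> * \<kappa> * A = C * \<gamma> * r * R ^ (DIM('a) + 2) * M powr (- (p * \<gamma>))"
        by (simp add: \<kappa>_def A_def power_add power2_eq_square)
      have nonneg: "F t \<ge> 0" for t by (simp add: F_def)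
      show ?thesis
        using decay_of_left_Dini[OF cont nonneg pos \<gamma> Dini', folded t0_eq, unfolded rate] by blast
    qed
    then show "\<And>t. 0 \<le> t \<Longrightarrow> F t \<le> F 0" and "\<And>t. t0 \<le> t \<Longrightarrow> F t \<le>
      (F 0 powr (- \<gamma>) + C * \<gamma> * r * R ^ (DIM('a) + 2) * M powr (- (p * \<gamma>)) * (t - t0)) powr (- (1 / \<gamma>))"
      by blast+
  qed
  moreover have "F 0 powr (- \<gamma>) = Lp_norm p u0 powr (- (p * \<gamma>))"
    unfolding F0 by (simp add: powr_powr)
  ultimately show "\<And>t. 0 \<le> t \<Longrightarrow> Lp_norm p (u t) powr p \<le> Lp_norm p u0 powr p"
    and "\<And>t. t0 \<le> t \<Longrightarrow> Lp_norm p (u t) powr p \<le>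
      (Lp_norm p u0 powr (- (p * \<gamma>))
       + C * \<gamma> * r * R ^ (DIM('a) + 2) * Lp_norm 1 u0 powr (- (p * \<gamma>)) * (t - t0))
      powr (- (1 / \<gamma>))"
    unfolding F0 M_def unfolding F_def by simp_all
qed

theorem theorem1p2:
  fixes p \<gamma> :: real and N :: nat
  assumes "N = CARD('n::finite)"
    and "p \<ge> 2"
    and "\<gamma> = 2 / (real N * (p - 1))"
  shows "\<exists>C>0.
    (\<forall>(J :: real ^ 'n \<Rightarrow> real) r R w.
       J \<in> borel_measurable lebesgue \<longrightarrow> (\<forall>z. 0 \<le> J z) \<longrightarrow> 0 < r \<longrightarrow> 0 < R \<longrightarrow>
       (\<forall>z. norm z < R \<longrightarrow> r \<le> J z) \<longrightarrow> w \<in> Lp_space 1 \<inter> Lp_space p \<longrightarrow>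
       energy p J w \<ge> ennreal (C * r *
         min (R ^ (N + 2) * Lp_norm 1 w powr (- (p * \<gamma>)) * Lp_norm p w powr (p * (1 + \<gamma>)))
             (R ^ N * Lp_norm p w powr p))) \<and>
    (\<forall>(J :: real ^ 'n \<Rightarrow> real) r R u0 u.
       J \<in> Lp_space 1 \<longrightarrow> (\<forall>z. 0 \<le> J z) \<longrightarrow> 0 < r \<longrightarrow> 0 < R \<longrightarrow>
       (\<forall>z. norm z < R \<longrightarrow> r \<le> J z) \<longrightarrow> u0 \<in> Lp_space 1 \<inter> Lp_space p \<longrightarrow>
       is_solution p J u0 u \<longrightarrow>
       (let t0 = max 0 (1 / (C * r * R ^ N) *
                   ln (R powr (2 / \<gamma>) * Lp_norm 1 u0 powr (- p) * Lp_norm p u0 powr p))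
        in (\<forall>t. 0 \<le> t \<and> t \<le> t0 \<longrightarrow> Lp_norm p (u t) powr p \<le> Lp_norm p u0 powr p) \<and>
           (\<forall>t\<ge>t0. Lp_norm p (u t) powr p \<le>
              (Lp_norm p u0 powr (- (p * \<gamma>))
               + C * \<gamma> * r * R ^ (N + 2) * Lp_norm 1 u0 powr (- (p * \<gamma>)) * (t - t0))
              powr (- (1 / \<gamma>)))))"
proof -
  have N: "N = DIM(real ^ 'n)" using assms(1) by simp
  note eqs = assms(3) N
  show ?thesis
    unfolding eqs Let_def
  proof (intro exI[of _ "energy_const TYPE(real ^ 'n) p"] conjI allI impI)
    show "energy_const TYPE(real ^ 'n) p > 0" by (rule energy_const_pos)
  next
    fix J w :: "real ^ 'n \<Rightarrow> real" and r R :: real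
    assume "\<forall>z. 0 \<le> J z" "0 < r" "0 < R" "\<forall>z. norm z < R \<longrightarrow> r \<le> J z" "w \<in> Lp_space 1 \<inter> Lp_space p"
    then show "ennreal (energy_const TYPE(real ^ 'n) p * r *
         min (R ^ (DIM(real ^ 'n) + 2) * Lp_norm 1 w powr (- (p * (2 / (real DIM(real ^ 'n) * (p - 1)))))
               * Lp_norm p w powr (p * (1 + 2 / (real DIM(real ^ 'n) * (p - 1)))))
             (R ^ DIM(real ^ 'n) * Lp_norm p w powr p)) \<le> energy p J w"
      by (intro energy_inequality[OF assms(2)]) auto
  qed (use nonlocal_diffusion_decay[OF assms(2)] in blast)+
qed

end
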